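(* For all $\varepsilon>0$, $\sigma>0$ and integers $T\ge 1$ (and every batch size $b\ge1$, with $n=bT$ records), it holds that $$\delta_{\mathcal B}(\varepsilon)\le\delta_{\mathcal S}(\varepsilon)\le\delta_{\mathcal D}(\varepsilon),$$ where $\delta_{\mathcal G}$ is the privacy loss curve of the mechanism $\mathrm{ABLQ}_{\mathcal G}$ with noise scale $\sigma$, for $\mathcal G$ the Balls-and-Bins generator $\mathcal B$, the Shuffle generator $\mathcal S$, and the Deterministic generator $\mathcal D$, respectively, each with $T$ batches.
   Context: Adaptive query method: let $\mathbb B^d:=\{v\in\mathbb R^d:\|v\|_2\le 1\}$. An adaptive query method is a map $\mathcal A:(\mathbb R^d)^*\times\mathcal X\to\mathbb B^d$ (where $(\mathbb R^d)^*$ is the set of finite sequences in $\mathbb R^d$), assumed measurable in the first argument. Let $\mathcal X_\bot:=\mathcal X\cup\{\bot\}$; $\mathcal A$ is extended by $\mathcal A(g_1,\dots,g_t;\bot)=\mathbf 0$ for all $g_1,\dots,g_t$. Adjacency (zeroing-out): $\boldsymbol x,\boldsymbol x'\in\mathcal X_\bot^n$ are adjacent, $\boldsymbol x\sim\boldsymbol x'$, if there is an index $i$ such that $x_j=x'_j$ for all $j\ne i$ and exactly one of $x_i,x'_i$ is in $\mathcal X$ while the other is $\bot$. Differential privacy: a mechanism $\mathcal M$ (a map from datasets to output distributions) satisfies $(\varepsilon,\delta)$-DP if for all adjacent $\boldsymbol x\sim\boldsymbol x'$ and all measurable events $E$, $\Pr[\mathcal M(\boldsymbol x)\in E]\le e^{\varepsilon}\Pr[\mathcal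 M(\boldsymbol x')\in E]+\delta$. Batch generators (on $n=bT$ records, output a possibly random sequence $(S_1,\dots,S_T)$ of subsets of $[n]$): Deterministic $\mathcal D$: $S_{t+1}=\{tb+1,\dots,tb+b\}$ for $t=0,\dots,T-1$. Shuffle $\mathcal S$: draw a uniformly random permutation $\pi$ of $[n]$ and set $S_{t+1}=\{\pi(tb+1),\dots,\pi(tb+b)\}$ for $t=0,\dots,T-1$. Balls-and-Bins $\mathcal B$: each $i\in[n]$ is independently placed in exactly one batch $S_t$ with $t$ uniformly random in $[T]$. Mechanism $\mathrm{ABLQ}_{\mathcal G}$ (with parameters $\sigma$, $\mathcal A$): on input $\boldsymbol x=(x_1,\dots,x_n)$, draw $(S_1,\dots,S_T)$ from $\mathcal G$; for $t=1,\dots,T$ in order, set $\psi_t(\cdot):=\mathcal A(g_1,\dots,g_{t-1};\cdot)$ and $g_t:=\sum_{i\in S_t}\psi_t(x_i)+\xi_t$ with fresh independent noise $\xi_t\sim\mathcal N(0,\sigma^2 I_d)$; output $(g_1,\dots,g_T)$. Privacy loss curve: $\delta_{\mathcal G}(\varepsilon)$ is the smallest $\delta\ge0$ such that $\mathrm{ABLQ}_{\mathcal G}$ (with the given $\sigma$, $T$, $n=bT$) satisfies $(\varepsilon,\delta)$-DP for all choices of the underlying adaptive query method $\mathcal A$ (over all data domains $\mathcal X$ and dimensions $d\ge1$). *)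

theory Defs
  imports "HOL-Probability.Probability" "HOL-Combinatorics.Permutations"
begin

section \<open>Differential privacy under zeroing-out adjacency\<close>

text \<open>
  Records and batches are indexed from 0.  A data domain is a type \<open>'x\<close>, and \<open>'x option\<close> is the
  domain extended by the null record \<open>None\<close>.
\<close>

definition adjacent :: "nat \<Rightarrow> 'x option list \<Rightarrow> 'x option list \<Rightarrow> bool" where
  "adjacent n x x' \<longleftrightarrow> length x = n \<and> length x' = n \<and>
     (\<exists>i<n. (\<forall>j<n. j \<noteq> i \<longrightarrow> x ! j = x' ! j) \<and> (x ! i = None) \<noteq> (x' ! i = None))"

definition differentially_private ::
    "('a \<Rightarrow> 'a \<Rightarrow> bool) \<Rightarrow> ('a \<Rightarrow> 'b measure) \<Rightarrow> real \<Rightarrow> real \<Rightarrow> bool" where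
  "differentially_private adj M \<epsilon> \<delta> \<longleftrightarrow>
     (\<forall>x x'. adj x x' \<longrightarrow>
        (\<forall>E\<in>sets (M x). measure (M x) E \<le> exp \<epsilon> * measure (M x') E + \<delta>))"


section \<open>Batch generators\<close>

text \<open>
  A generator is a distribution on lists of \<open>T\<close> batches, each a subset of \<open>{..<b * T}\<close>.
\<close>

definition deterministic_batches :: "nat \<Rightarrow> nat \<Rightarrow> nat set list pmf" where
  "deterministic_batches b T = return_pmf (map (\<lambda>t. {t * b..<t * b + b}) [0..<T])"

definition shuffle_batches :: "nat \<Rightarrow> nat \<Rightarrow> nat set list pmf" where
  "shuffle_batches b T =
     map_pmf (\<lambda>\<pi>. map (\<lambda>t. \<pi> ` {t * b..<t * b + b}) [0..<T])
       (pmf_of_set {\<pi>. \<pi> permutes {..<b * T}})"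

text \<open>
  The value 0 passed to \<open>Pi_pmf\<close> only fixes the assignment outside the index set \<open>{..<b * T}\<close>.
\<close>

definition balls_and_bins_batches :: "nat \<Rightarrow> nat \<Rightarrow> nat set list pmf" where
  "balls_and_bins_batches b T =
     map_pmf (\<lambda>f. map (\<lambda>t. {i. i < b * T \<and> f i = t}) [0..<T])
       (Pi_pmf {..<b * T} 0 (\<lambda>_. pmf_of_set {..<T}))"


section \<open>Adaptive batch linear queries\<close>

text \<open>
  The dimension \<open>d\<close> is quantified inside the privacy loss curve, so a vector of dimension \<open>d\<close> is a
  function \<open>nat \<Rightarrow> real\<close> that is \<open>undefined\<close> outside \<open>{..<d}\<close>.
\<close>

abbreviation rvec :: "nat \<Rightarrow> (nat \<Rightarrow> real) measure" where
  "rvec d \<equiv> Pi\<^sub>M {..<d} (\<lambda>_. borel)"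

definition gaussian_noise :: "nat \<Rightarrow> real \<Rightarrow> (nat \<Rightarrow> real) measure" where
  "gaussian_noise d \<sigma> = Pi\<^sub>M {..<d} (\<lambda>_. density lborel (normal_density 0 \<sigma>))"

text \<open>
  The finite sequences of vectors form the disjoint union of the \<open>t\<close>-fold powers of \<open>rvec d\<close>, so
  measurability in the first argument is measurability for each length \<open>t\<close>.
\<close>

definition adaptive_query_method ::
    "nat \<Rightarrow> ((nat \<Rightarrow> real) list \<Rightarrow> 'x \<Rightarrow> (nat \<Rightarrow> real)) \<Rightarrow> bool" where
  "adaptive_query_method d A \<longleftrightarrow>
     (\<forall>x. \<forall>gs\<in>lists (space (rvec d)).
        A gs x \<in> space (rvec d) \<and> L2_set (A gs x) {..<d} \<le> 1) \<and>
     (\<forall>x t. (\<lambda>g. A (map g [0..<t]) x) \<in> measurable (Pi\<^sub>M {..<t} (\<lambda>_. rvec d)) (rvec d))"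

fun extended_query ::
    "nat \<Rightarrow> ((nat \<Rightarrow> real) list \<Rightarrow> 'x \<Rightarrow> (nat \<Rightarrow> real)) \<Rightarrow>
     (nat \<Rightarrow> real) list \<Rightarrow> 'x option \<Rightarrow> (nat \<Rightarrow> real)" where
  "extended_query d A gs None = (\<lambda>j\<in>{..<d}. 0)"
| "extended_query d A gs (Some x) = A gs x"

text \<open>
  \<open>answers d A S x \<xi> t\<close> lists the first \<open>t\<close> answers when the batches \<open>S\<close> and the noise vectors
  \<open>\<xi> 0, \<xi> 1, \<dots>\<close> are given.
\<close>

primrec answers ::
    "nat \<Rightarrow> ((nat \<Rightarrow> real) list \<Rightarrow> 'x \<Rightarrow> (nat \<Rightarrow> real)) \<Rightarrow> nat set list \<Rightarrow> 'x option list \<Rightarrow>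
     (nat \<Rightarrow> nat \<Rightarrow> real) \<Rightarrow> nat \<Rightarrow> (nat \<Rightarrow> real) list" where
  "answers d A S x \<xi> 0 = []"
| "answers d A S x \<xi> (Suc t) =
     answers d A S x \<xi> t @
       [\<lambda>j\<in>{..<d}. (\<Sum>i\<in>S ! t. extended_query d A (answers d A S x \<xi> t) (x ! i) j) + \<xi> t j]"

definition ablq_given ::
    "nat \<Rightarrow> real \<Rightarrow> nat \<Rightarrow> ((nat \<Rightarrow> real) list \<Rightarrow> 'x \<Rightarrow> (nat \<Rightarrow> real)) \<Rightarrow> 'x option list \<Rightarrow>
     nat set list \<Rightarrow> (nat \<Rightarrow> nat \<Rightarrow> real) measure" where
  "ablq_given d \<sigma> T A x S =
     distr (Pi\<^sub>M {..<T} (\<lambda>_. gaussian_noise d \<sigma>)) (Pi\<^sub>M {..<T} (\<lambda>_. rvec d))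
       (\<lambda>\<xi>. \<lambda>t\<in>{..<T}. answers d A S x \<xi> T ! t)"

definition ablq ::
    "nat \<Rightarrow> real \<Rightarrow> nat \<Rightarrow> ((nat \<Rightarrow> real) list \<Rightarrow> 'x \<Rightarrow> (nat \<Rightarrow> real)) \<Rightarrow> nat set list pmf \<Rightarrow>
     'x option list \<Rightarrow> (nat \<Rightarrow> nat \<Rightarrow> real) measure" where
  "ablq d \<sigma> T A G x = measure_pmf G \<bind> ablq_given d \<sigma> T A x"

definition ablq_private ::
    "'x itself \<Rightarrow> (nat \<Rightarrow> nat \<Rightarrow> nat set list pmf) \<Rightarrow> real \<Rightarrow> nat \<Rightarrow> nat \<Rightarrow> real \<Rightarrow> real \<Rightarrow> bool" where
  "ablq_private _ G \<sigma> b T \<epsilon> \<delta> \<longleftrightarrow>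
     (\<forall>d\<ge>1. \<forall>A :: (nat \<Rightarrow> real) list \<Rightarrow> 'x \<Rightarrow> (nat \<Rightarrow> real). adaptive_query_method d A \<longrightarrow>
        differentially_private (adjacent (b * T)) (ablq d \<sigma> T A (G b T)) \<epsilon> \<delta>)"

text \<open>
  HOL cannot quantify over all types \<open>'x\<close> inside a definition, so the data domain is a parameter.
  By \<open>privacy_loss_curve_universal\<close> below the curve is the same for every infinite \<open>'x\<close>, and by
  \<open>ablq_private_any_domain\<close> any infinite \<open>'x\<close> yields the smallest \<open>\<delta>\<close> that is valid for all data
  domains simultaneously.
\<close>

definition privacy_loss_curve ::
    "'x itself \<Rightarrow> (nat \<Rightarrow> nat \<Rightarrow> nat set list pmf) \<Rightarrow> real \<Rightarrow> nat \<Rightarrow> nat \<Rightarrow> real \<Rightarrow> real" where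
  "privacy_loss_curve X G \<sigma> b T \<epsilon> = (LEAST \<delta>. 0 \<le> \<delta> \<and> ablq_private X G \<sigma> b T \<epsilon> \<delta>)"


section \<open>Well-definedness\<close>

lemma sets_gaussian_noise: "sets (gaussian_noise d \<sigma>) = sets (rvec d)"
  unfolding gaussian_noise_def by (intro sets_PiM_cong) auto

lemma prob_space_gaussian_noise:
  assumes "\<sigma> > 0"
  shows "prob_space (gaussian_noise d \<sigma>)"
  unfolding gaussian_noise_def
  by (intro prob_space_PiM) (rule prob_space_normal_density[OF assms])

lemma length_answers [simp]: "length (answers d A S x \<xi> t) = t"
  by (induction t) auto

lemma answers_measurable:
  assumes A: "adaptive_query_method d A" and "t \<le> T"
  shows "(\<lambda>\<xi>. \<lambda>s\<in>{..<t}. answers d A S x \<xi> t ! s)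
     \<in> measurable (Pi\<^sub>M {..<T} (\<lambda>_. rvec d)) (Pi\<^sub>M {..<t} (\<lambda>_. rvec d))"
  using \<open>t \<le> T\<close>
proof (induction t)
  case 0
  show ?case by (simp add: measurable_restrict)
next
  case (Suc t)
  let ?N = "Pi\<^sub>M {..<T} (\<lambda>_. rvec d)"
  let ?f = "\<lambda>\<xi>. \<lambda>s\<in>{..<t}. answers d A S x \<xi> t ! s"
  have f: "?f \<in> measurable ?N (Pi\<^sub>M {..<t} (\<lambda>_. rvec d))"
    by (rule Suc.IH) (use Suc.prems in simp)
  have ans: "answers d A S x \<xi> t = map (?f \<xi>) [0..<t]" for \<xi>
    by (rule nth_equalityI) auto
  have q: "(\<lambda>\<xi>. extended_query d A (answers d A S x \<xi> t) r) \<in> measurable ?N (rvec d)" for r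
  proof (cases r)
    case None
    then show ?thesis by (auto intro!: measurable_restrict)
  next
    case (Some y)
    have "(\<lambda>g. A (map g [0..<t]) y) \<in> measurable (Pi\<^sub>M {..<t} (\<lambda>_. rvec d)) (rvec d)"
      using A unfolding adaptive_query_method_def by blast
    from measurable_compose[OF f this] show ?thesis
      using Some ans by (simp cong: measurable_cong)
  qed
  have qj: "(\<lambda>\<xi>. extended_query d A (answers d A S x \<xi> t) r j) \<in> borel_measurable ?N"
    if "j < d" for r j
    using measurable_compose[OF q measurable_component_singleton[of j "{..<d}" "\<lambda>_. borel"]] that
    by simp
  have xi: "(\<lambda>\<xi>. \<xi> t j) \<in> borel_measurable ?N" if "j < d" for j
    using measurable_compose[OF measurable_component_singleton[of t "{..<T}" "\<lambda>_. rvec d"]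
        measurable_component_singleton[of j "{..<d}" "\<lambda>_. borel"]] that Suc.prems
    by simp
  have new: "(\<lambda>\<xi>. \<lambda>j\<in>{..<d}.
      (\<Sum>i\<in>S ! t. extended_query d A (answers d A S x \<xi> t) (x ! i) j) + \<xi> t j)
      \<in> measurable ?N (rvec d)" (is "?g \<in> _")
    by (intro measurable_restrict borel_measurable_add borel_measurable_sum qj xi) auto
  have "(\<lambda>\<xi>. (?f \<xi>)(t := ?g \<xi>)) \<in> measurable ?N (Pi\<^sub>M {..<Suc t} (\<lambda>_. rvec d))"
    by (rule measurable_fun_upd[OF _ f new]) auto
  also have "(\<lambda>\<xi>. (?f \<xi>)(t := ?g \<xi>)) = (\<lambda>\<xi>. \<lambda>s\<in>{..<Suc t}. answers d A S x \<xi> (Suc t) ! s)"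
    by (intro ext) (auto simp: nth_append restrict_def less_Suc_eq)
  finally show ?case .
qed

lemma ablq_given_measurable:
  assumes "adaptive_query_method d A"
  shows "(\<lambda>\<xi>. \<lambda>t\<in>{..<T}. answers d A S x \<xi> T ! t)
    \<in> measurable (Pi\<^sub>M {..<T} (\<lambda>_. gaussian_noise d \<sigma>)) (Pi\<^sub>M {..<T} (\<lambda>_. rvec d))"
proof -
  have "sets (Pi\<^sub>M {..<T} (\<lambda>_. gaussian_noise d \<sigma>)) = sets (Pi\<^sub>M {..<T} (\<lambda>_. rvec d))"
    by (intro sets_PiM_cong) (auto simp: sets_gaussian_noise)
  then show ?thesis
    using answers_measurable[OF assms order_refl, of S x T]
    by (simp cong: measurable_cong_sets)
qed

lemma ablq_given_in_prob_algebra: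
  assumes "\<sigma> > 0" "adaptive_query_method d A"
  shows "ablq_given d \<sigma> T A x S \<in> space (prob_algebra (Pi\<^sub>M {..<T} (\<lambda>_. rvec d)))"
proof -
  interpret prob_space "Pi\<^sub>M {..<T} (\<lambda>_. gaussian_noise d \<sigma>)"
    by (intro prob_space_PiM prob_space_gaussian_noise assms)
  show ?thesis
    unfolding ablq_given_def space_prob_algebra
    using prob_space_distr[OF ablq_given_measurable[OF assms(2)]] by simp
qed

lemma ablq_in_prob_algebra:
  assumes "\<sigma> > 0" "adaptive_query_method d A"
  shows "ablq d \<sigma> T A G x \<in> space (prob_algebra (Pi\<^sub>M {..<T} (\<lambda>_. rvec d)))"
proof -
  have 1: "measure_pmf G \<in> space (prob_algebra (count_space UNIV))"
    by (simp add: space_prob_algebra measure_pmf.prob_space_axioms)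
  have 2: "ablq_given d \<sigma> T A x \<in> count_space UNIV \<rightarrow>\<^sub>M prob_algebra (Pi\<^sub>M {..<T} (\<lambda>_. rvec d))"
    using ablq_given_in_prob_algebra[OF assms] by simp
  show ?thesis
    unfolding ablq_def space_prob_algebra
    using prob_space_bind'[OF 1 2] sets_bind'[OF 1 2] by simp
qed

lemma ablq_private_one:
  assumes "\<sigma> > 0"
  shows "ablq_private X G \<sigma> b T \<epsilon> 1"
  unfolding ablq_private_def differentially_private_def
proof (intro allI impI ballI)
  fix d and A :: "(nat \<Rightarrow> real) list \<Rightarrow> 'a \<Rightarrow> (nat \<Rightarrow> real)" and x x' E
  assume A: "adaptive_query_method d A"
  have "prob_space (ablq d \<sigma> T A (G b T) x)"
    using ablq_in_prob_algebra[OF assms A] by (auto simp: space_prob_algebra)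
  then have "measure (ablq d \<sigma> T A (G b T) x) E \<le> 1"
    by (rule prob_space.prob_le_1)
  then show "measure (ablq d \<sigma> T A (G b T) x) E
      \<le> exp \<epsilon> * measure (ablq d \<sigma> T A (G b T) x') E + 1"
    by (smt (verit) exp_ge_zero measure_nonneg mult_nonneg_nonneg)
qed

theorem privacy_loss_curve_is_least:
  assumes "\<sigma> > 0"
  shows "privacy_loss_curve X G \<sigma> b T \<epsilon> \<ge> 0"
    and "ablq_private X G \<sigma> b T \<epsilon> (privacy_loss_curve X G \<sigma> b T \<epsilon>)"
    and "\<delta> \<ge> 0 \<Longrightarrow> ablq_private X G \<sigma> b T \<epsilon> \<delta> \<Longrightarrow> privacy_loss_curve X G \<sigma> b T \<epsilon> \<le> \<delta>"
proof -
  define D where "D = {\<delta>. 0 \<le> \<delta> \<and> ablq_private X G \<sigma> b T \<epsilon> \<delta>}"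
  have ne: "D \<noteq> {}"
    using ablq_private_one[OF assms, of X G b T \<epsilon>] unfolding D_def
    by (metis (mono_tags, lifting) empty_iff mem_Collect_eq zero_le_one)
  have bdd: "bdd_below D"
    by (rule bdd_belowI[of _ 0]) (simp add: D_def)
  have low: "Inf D \<le> \<delta>" if "\<delta> \<in> D" for \<delta>
    using that bdd by (rule cInf_lower)
  have nn: "0 \<le> Inf D"
    by (rule cInf_greatest[OF ne]) (simp add: D_def)
  have "ablq_private X G \<sigma> b T \<epsilon> (Inf D)"
    unfolding ablq_private_def differentially_private_def
  proof (intro allI impI ballI)
    fix d and A :: "(nat \<Rightarrow> real) list \<Rightarrow> 'a \<Rightarrow> (nat \<Rightarrow> real)" and x x' E
    assume H: "d \<ge> 1" "adaptive_query_method d A" "adjacent (b * T) x x'"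
      "E \<in> sets (ablq d \<sigma> T A (G b T) x)"
    have "measure (ablq d \<sigma> T A (G b T) x) E
        - exp \<epsilon> * measure (ablq d \<sigma> T A (G b T) x') E \<le> Inf D"
    proof (rule cInf_greatest[OF ne])
      fix \<delta> assume "\<delta> \<in> D"
      then have "ablq_private X G \<sigma> b T \<epsilon> \<delta>" by (simp add: D_def)
      then have "measure (ablq d \<sigma> T A (G b T) x) E
          \<le> exp \<epsilon> * measure (ablq d \<sigma> T A (G b T) x') E + \<delta>"
        using H unfolding ablq_private_def differentially_private_def by blast
      then show "measure (ablq d \<sigma> T A (G b T) x) E
          - exp \<epsilon> * measure (ablq d \<sigma> T A (G b T) x') E \<le> \<delta>"
        by simp
    qed
    then show "measure (ablq d \<sigma> T A (G b T) x) E
        \<le> exp \<epsilon> * measure (ablq d \<sigma> T A (G b T) x') E + Inf D"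
      by simp
  qed
  with nn have mem: "Inf D \<in> D" by (simp add: D_def)
  have eq: "privacy_loss_curve X G \<sigma> b T \<epsilon> = Inf D"
    unfolding privacy_loss_curve_def using mem low
    by (intro Least_equality) (auto simp: D_def)
  show "privacy_loss_curve X G \<sigma> b T \<epsilon> \<ge> 0"
    and "ablq_private X G \<sigma> b T \<epsilon> (privacy_loss_curve X G \<sigma> b T \<epsilon>)"
    using mem eq by (simp_all add: D_def)
  show "privacy_loss_curve X G \<sigma> b T \<epsilon> \<le> \<delta>" if "\<delta> \<ge> 0" "ablq_private X G \<sigma> b T \<epsilon> \<delta>"
    using low that eq by (simp add: D_def)
qed


section \<open>Independence of the data domain\<close>

definition valid_generator :: "(nat \<Rightarrow> nat \<Rightarrow> nat set list pmf) \<Rightarrow> bool" where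
  "valid_generator G \<longleftrightarrow>
     (\<forall>b T. \<forall>S\<in>set_pmf (G b T). length S = T \<and> (\<forall>t<T. S ! t \<subseteq> {..<b * T}))"

lemma batch_index_less:
  fixes i t b T :: nat
  assumes "t < T" "i < t * b + b"
  shows "i < b * T"
proof -
  have "t * b + b = b * Suc t" by simp
  also have "\<dots> \<le> b * T" using assms(1) by (intro mult_le_mono2) simp
  finally show ?thesis using assms(2) by simp
qed

lemma valid_deterministic: "valid_generator deterministic_batches"
  unfolding valid_generator_def deterministic_batches_def
  using batch_index_less by auto

lemma valid_shuffle: "valid_generator shuffle_batches"
  unfolding valid_generator_def
proof (intro allI ballI)
  fix b T S
  assume "S \<in> set_pmf (shuffle_batches b T)"
  moreover have "{\<pi>. \<pi> permutes {..<b * T}} \<noteq> {}"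
    using permutes_id by blast
  ultimately obtain \<pi> where \<pi>: "\<pi> permutes {..<b * T}"
    and S: "S = map (\<lambda>t. \<pi> ` {t * b..<t * b + b}) [0..<T]"
    by (auto simp: shuffle_batches_def set_pmf_of_set finite_permutations)
  show "length S = T \<and> (\<forall>t<T. S ! t \<subseteq> {..<b * T})"
    using S permutes_in_image[OF \<pi>] batch_index_less by auto
qed

lemma valid_balls_and_bins: "valid_generator balls_and_bins_batches"
  unfolding valid_generator_def balls_and_bins_batches_def by auto

lemma ablq_private_any_domain:
  assumes inf: "infinite (UNIV :: 'u set)" and \<sigma>: "\<sigma> > 0" and G: "valid_generator G"
    and priv: "ablq_private TYPE('u) G \<sigma> b T \<epsilon> \<delta>"
  shows "ablq_private TYPE('y) G \<sigma> b T \<epsilon> \<delta>"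
  unfolding ablq_private_def differentially_private_def
proof (intro allI impI ballI)
  fix d and A :: "(nat \<Rightarrow> real) list \<Rightarrow> 'y \<Rightarrow> (nat \<Rightarrow> real)" and x x' E
  assume d: "d \<ge> 1" and A: "adaptive_query_method d A" and adj: "adjacent (b * T) x x'"
    and E: "E \<in> sets (ablq d \<sigma> T A (G b T) x)"
  define F where "F = (\<Union>r\<in>set x \<union> set x'. set_option r)"
  have "finite F" unfolding F_def by auto
  then obtain f :: "'y \<Rightarrow> 'u" where f: "inj_on f F"
    using inf by (metis finite_imp_inj_to_nat_seg infinite_countable_subset comp_inj_on
        inj_on_subset subset_UNIV)
  define h where "h = inv_into F f"
  have hf: "h (f y) = y" if "y \<in> F" for y
    unfolding h_def using f that by simp
  define A' where "A' = (\<lambda>gs u. A gs (h u))"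
  have A': "adaptive_query_method d A'"
    using A unfolding adaptive_query_method_def A'_def by blast
  have len: "length x = b * T" "length x' = b * T"
    using adj unfolding adjacent_def by auto
  have ans: "answers d A' S (map (map_option f) z) \<xi> t = answers d A S z \<xi> t"
    if S: "\<forall>t<T. S ! t \<subseteq> {..<b * T}" and z: "length z = b * T" "(\<Union>r\<in>set z. set_option r) \<subseteq> F"
      and t: "t \<le> T" for S z \<xi> t
    using t
  proof (induction t)
    case (Suc t)
    have q: "extended_query d A' gs (map (map_option f) z ! i) = extended_query d A gs (z ! i)"
      if "i \<in> S ! t" for gs i
    proof -
      have "S ! t \<subseteq> {..<b * T}" using S Suc.prems by simp
      then have i: "i < length z" using that z by auto
      show ?thesis
      proof (cases "z ! i")
        case (Some y)
        then have "y \<in> F" using z i nth_mem[OF i] by force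
        then show ?thesis using Some i hf by (simp add: A'_def)
      qed (use i in simp)
    qed
    show ?case using Suc q by (simp cong: sum.cong)
  qed simp
  have mech: "ablq d \<sigma> T A' (G b T) (map (map_option f) z) = ablq d \<sigma> T A (G b T) z"
    if z: "length z = b * T" "(\<Union>r\<in>set z. set_option r) \<subseteq> F" for z
    unfolding ablq_def
  proof (rule bind_measure_pmf_cong)
    show "ablq_given d \<sigma> T A' (map (map_option f) z) S
        \<in> space (subprob_algebra (Pi\<^sub>M {..<T} (\<lambda>_. rvec d)))" for S
      using ablq_given_in_prob_algebra[OF \<sigma> A'] by (auto simp: space_prob_algebra
          space_subprob_algebra prob_space_imp_subprob_space)
    show "ablq_given d \<sigma> T A z S \<in> space (subprob_algebra (Pi\<^sub>M {..<T} (\<lambda>_. rvec d)))" for S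
      using ablq_given_in_prob_algebra[OF \<sigma> A] by (auto simp: space_prob_algebra
          space_subprob_algebra prob_space_imp_subprob_space)
    fix S assume "S \<in> set_pmf (G b T)"
    then have "\<forall>t<T. S ! t \<subseteq> {..<b * T}" using G unfolding valid_generator_def by blast
    then show "ablq_given d \<sigma> T A' (map (map_option f) z) S = ablq_given d \<sigma> T A z S"
      unfolding ablq_given_def using ans[OF _ z order_refl] by simp
  qed
  obtain i where "i < b * T" "\<forall>j<b * T. j \<noteq> i \<longrightarrow> x ! j = x' ! j" "(x ! i = None) \<noteq> (x' ! i = None)"
    using adj unfolding adjacent_def by blast
  then have "adjacent (b * T) (map (map_option f) x) (map (map_option f) x')"
    unfolding adjacent_def using len by (intro conjI exI[of _ i]) auto
  moreover have mx: "ablq d \<sigma> T A' (G b T) (map (map_option f) x) = ablq d \<sigma> T A (G b T) x"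
    by (rule mech[OF len(1)]) (simp add: F_def)
  ultimately have "measure (ablq d \<sigma> T A' (G b T) (map (map_option f) x)) E
      \<le> exp \<epsilon> * measure (ablq d \<sigma> T A' (G b T) (map (map_option f) x')) E + \<delta>"
    using priv d A' E mx unfolding ablq_private_def differentially_private_def by metis
  then show "measure (ablq d \<sigma> T A (G b T) x) E
      \<le> exp \<epsilon> * measure (ablq d \<sigma> T A (G b T) x') E + \<delta>"
    using mech[OF len(1)] mech[OF len(2)] by (simp add: F_def)
qed

theorem privacy_loss_curve_universal:
  assumes "infinite (UNIV :: 'u set)" "infinite (UNIV :: 'v set)" "\<sigma> > 0" "valid_generator G"
  shows "privacy_loss_curve TYPE('u) G \<sigma> b T \<epsilon> = privacy_loss_curve TYPE('v) G \<sigma> b T \<epsilon>"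
proof -
  have "ablq_private TYPE('u) G \<sigma> b T \<epsilon> = ablq_private TYPE('v) G \<sigma> b T \<epsilon>"
    using ablq_private_any_domain[OF assms(1,3,4), where 'y = 'v]
      ablq_private_any_domain[OF assms(2,3,4), where 'y = 'u] by blast
  then show ?thesis unfolding privacy_loss_curve_def by simp
qed

end

theory Submission
  imports Defs
begin

text \<open>
  Shuffling is the deterministic generator run on a randomly permuted data set, and permuting
  preserves adjacency; this gives the second inequality.

  For the first, condition on the batches of all records but the differing one.  Inserting that
  record into batch \<open>s\<close> shifts the noise of step \<open>s\<close> by a vector \<open>v\<^sub>s\<close> of norm at most 1 that depends
  only on the earlier answers, so it multiplies the law of the output by a Gaussian likelihood ratio
  \<open>L\<^sub>s\<close>, and Balls-and-Bins yields the average of the \<open>L\<^sub>s\<close>.  Both hockey-stick divergences are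
  expectations of convex functions of \<open>\<Sum>s. L\<^sub>s\<close>.  By Jensen's inequality, applied one step at a time,
  such an expectation only grows if each \<open>L\<^sub>s\<close> is replaced by the ratio of a shift of norm exactly 1.
  The extremal value is attained by the shuffle mechanism for the constant query 1 in dimension 1
  and a data set with a single non-null record, which falls into a uniformly random batch.
\<close>

section \<open>Shifts of Gaussian product measures\<close>

abbreviation normal_measure :: "real \<Rightarrow> real measure" where
  "normal_measure \<sigma> \<equiv> density lborel (normal_density 0 \<sigma>)"

lemma sets_PiM_normal_measure [measurable_cong]:
  "sets (Pi\<^sub>M J (\<lambda>_. normal_measure \<sigma>)) = sets (Pi\<^sub>M J (\<lambda>_. borel))"
  by (intro sets_PiM_cong) auto

lemma product_sigma_finite_normal:
  "\<sigma> > 0 \<Longrightarrow> product_sigma_finite (\<lambda>_. normal_measure \<sigma>)"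
  unfolding product_sigma_finite_def
  by (intro allI prob_space_imp_sigma_finite prob_space_normal_density)

text \<open>The density of the Gaussian with mean \<open>v\<close> and covariance
  \<open>\<sigma>\<^sup>2\<close> times the identity, relative to the centred one, on the
  coordinates \<open>J\<close>. This is the likelihood ratio of an observation
  \<open>y\<close>.\<close>

definition shift_density :: "real \<Rightarrow> 'i set \<Rightarrow> ('i \<Rightarrow> real) \<Rightarrow> ('i \<Rightarrow> real) \<Rightarrow> real" where
  "shift_density \<sigma> J v y = exp (((\<Sum>j\<in>J. v j * y j) - (\<Sum>j\<in>J. (v j)\<^sup>2) / 2) / \<sigma>\<^sup>2)"

lemma shift_density_nonneg [simp]: "0 \<le> shift_density \<sigma> J v y"
  by (simp add: shift_density_def)

text \<open>Completing the square turns the centred density times the exponential factor into the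
  density with mean \<open>c\<close>; translation invariance of Lebesgue measure then moves the mean
  into the argument of \<open>h\<close>.\<close>

lemma nn_integral_normal_shift:
  assumes \<sigma>: "\<sigma> > 0" and [measurable]: "h \<in> borel_measurable borel"
  shows "(\<integral>\<^sup>+ y. h (y + c) \<partial>normal_measure \<sigma>)
    = (\<integral>\<^sup>+ y. h y * ennreal (exp ((c * y - c\<^sup>2 / 2) / \<sigma>\<^sup>2)) \<partial>normal_measure \<sigma>)"
proof -
  have dens: "normal_density 0 \<sigma> y * exp ((c * y - c\<^sup>2 / 2) / \<sigma>\<^sup>2) = normal_density c \<sigma> y" for y
  proof -
    have "- (y - 0)\<^sup>2 / (2 * \<sigma>\<^sup>2) + (c * y - c\<^sup>2 / 2) / \<sigma>\<^sup>2 = - (y - c)\<^sup>2 / (2 * \<sigma>\<^sup>2)"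
      using \<sigma> by (simp add: divide_simps) (simp add: power2_eq_square algebra_simps)
    then show ?thesis
      unfolding normal_density_def by (metis exp_add mult.assoc)
  qed
  have "(\<integral>\<^sup>+ y. h y * ennreal (exp ((c * y - c\<^sup>2 / 2) / \<sigma>\<^sup>2)) \<partial>normal_measure \<sigma>)
     = (\<integral>\<^sup>+ y. h y * ennreal (normal_density c \<sigma> y) \<partial>lborel)"
    by (subst nn_integral_density)
      (auto intro!: nn_integral_cong simp: dens[symmetric] ennreal_mult mult_ac)
  also have "\<dots> = (\<integral>\<^sup>+ y. h (c + 1 * y) * ennreal (normal_density c \<sigma> (c + 1 * y)) \<partial>lborel)"
    by (subst nn_integral_real_affine[where c = 1 and t = c]) auto
  also have "\<dots> = (\<integral>\<^sup>+ y. h (y + c) \<partial>normal_measure \<sigma>)"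
    by (subst nn_integral_density) (auto simp: normal_density_def mult.commute add.commute)
  finally show ?thesis by simp
qed

text \<open>The density factorises over coordinates, so the one-dimensional shift is applied to the
  inner integral over the new coordinate and the induction hypothesis to the rest.\<close>

lemma nn_integral_PiM_normal_shift:
  assumes \<sigma>: "\<sigma> > 0" and J: "finite J" and h: "h \<in> borel_measurable (Pi\<^sub>M J (\<lambda>_. borel))"
  shows "(\<integral>\<^sup>+ y. h (\<lambda>j\<in>J. y j + v j) \<partial>Pi\<^sub>M J (\<lambda>_. normal_measure \<sigma>))
    = (\<integral>\<^sup>+ y. h y * ennreal (shift_density \<sigma> J v y) \<partial>Pi\<^sub>M J (\<lambda>_. normal_measure \<sigma>))"
  using J h
proof (induction J arbitrary: h rule: finite_induct)
  case empty
  interpret product_sigma_finite "\<lambda>_. normal_measure \<sigma>"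
    by (rule product_sigma_finite_normal[OF \<sigma>])
  interpret P: prob_space "Pi\<^sub>M ({} :: 'a set) (\<lambda>_. normal_measure \<sigma>)"
    by (intro prob_space_PiM prob_space_normal_density \<sigma>)
  show ?case
    using P.emeasure_space_1 by (simp add: nn_integral_empty shift_density_def restrict_def)
next
  case (insert k J)
  note h [measurable] = insert.prems
  interpret nm: prob_space "normal_measure \<sigma>" by (rule prob_space_normal_density[OF \<sigma>])
  interpret product_sigma_finite "\<lambda>_. normal_measure \<sigma>"
    by (rule product_sigma_finite_normal[OF \<sigma>])
  let ?N = "\<lambda>J. Pi\<^sub>M J (\<lambda>_. normal_measure \<sigma>)"
  have upd: "(\<lambda>(y, u). y(k := u))
      \<in> Pi\<^sub>M J (\<lambda>_. borel) \<Otimes>\<^sub>M normal_measure \<sigma> \<rightarrow>\<^sub>M Pi\<^sub>M (insert k J) (\<lambda>_. borel)"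
    by (simp cong: measurable_cong_sets add: measurable_add_dim)
  have hu: "(\<lambda>u. h (y(k := u))) \<in> borel_measurable borel"
    if "y \<in> space (Pi\<^sub>M J (\<lambda>_. borel :: real measure))" for y
    using insert.hyps(2)
    by (rule measurable_compose[OF measurable_component_update[OF that] h])
  have c1: "(\<lambda>y. \<lambda>j\<in>J. y j + v j) \<in> Pi\<^sub>M J (\<lambda>_. borel) \<rightarrow>\<^sub>M Pi\<^sub>M J (\<lambda>_. borel)"
    by measurable
  have c: "(\<lambda>y. \<lambda>j\<in>insert k J. y j + v j)
      \<in> Pi\<^sub>M (insert k J) (\<lambda>_. borel) \<rightarrow>\<^sub>M Pi\<^sub>M (insert k J) (\<lambda>_. borel)"
    by measurable
  let ?l = "\<lambda>u. ennreal (exp ((v k * u - (v k)\<^sup>2 / 2) / \<sigma>\<^sup>2))"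
  \<comment> \<open>\<open>H\<close> is the inner integral after coordinate \<open>k\<close> has
    been shifted, seen as a function of the other coordinates. The induction hypothesis is used for
    \<open>H\<close> instead of \<open>h\<close>, hence the induction generalises over
    \<open>h\<close>.\<close>
  define H where "H y = (\<integral>\<^sup>+ u. h (y(k := u)) * ?l u \<partial>normal_measure \<sigma>)" for y
  have H: "H \<in> borel_measurable (Pi\<^sub>M J (\<lambda>_. borel))"
    unfolding H_def
    by (intro nm.borel_measurable_nn_integral)
      (use measurable_compose[OF upd h] in \<open>auto simp: case_prod_beta'\<close>)
  have sd: "shift_density \<sigma> (insert k J) v (y(k := u))
      = exp ((v k * u - (v k)\<^sup>2 / 2) / \<sigma>\<^sup>2) * shift_density \<sigma> J v y" for y u
  proof -
    have "(\<Sum>j\<in>J. v j * (y(k := u)) j) = (\<Sum>j\<in>J. v j * y j)"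
      using insert.hyps by (intro sum.cong) auto
    then show ?thesis
      unfolding shift_density_def mult_exp_exp add_divide_distrib[symmetric]
      using insert.hyps by (intro arg_cong[where f = "\<lambda>a. exp (a / \<sigma>\<^sup>2)"]) (simp add: field_simps)
  qed
  have sdm: "shift_density \<sigma> (insert k J) v \<in> borel_measurable (Pi\<^sub>M (insert k J) (\<lambda>_. borel))"
    unfolding shift_density_def by measurable
  have "(\<integral>\<^sup>+ y. h (\<lambda>j\<in>insert k J. y j + v j) \<partial>?N (insert k J))
      = (\<integral>\<^sup>+ y. \<integral>\<^sup>+ u. h (\<lambda>j\<in>insert k J. (y(k := u)) j + v j) \<partial>normal_measure \<sigma> \<partial>?N J)"
    by (rule product_nn_integral_insert[OF insert.hyps(1,2)])
      (use measurable_compose[OF c h] in \<open>simp cong: measurable_cong_sets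
        add: sets_PiM_normal_measure\<close>)
  also have "\<dots> = (\<integral>\<^sup>+ y. \<integral>\<^sup>+ u. h ((\<lambda>j\<in>J. y j + v j)(k := u + v k)) \<partial>normal_measure \<sigma> \<partial>?N J)"
    using insert.hyps(2) by (intro nn_integral_cong arg_cong[where f = h]) auto
  also have "\<dots> = (\<integral>\<^sup>+ y. H (\<lambda>j\<in>J. y j + v j) \<partial>?N J)"
    unfolding H_def
    by (intro nn_integral_cong nn_integral_normal_shift[OF \<sigma>] hu) (auto simp: space_PiM)
  also have "\<dots> = (\<integral>\<^sup>+ y. H y * ennreal (shift_density \<sigma> J v y) \<partial>?N J)"
    by (rule insert.IH[OF H])
  also have "\<dots> = (\<integral>\<^sup>+ y. \<integral>\<^sup>+ u. h (y(k := u))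
      * ennreal (shift_density \<sigma> (insert k J) v (y(k := u))) \<partial>normal_measure \<sigma> \<partial>?N J)"
  proof (intro nn_integral_cong)
    fix y assume "y \<in> space (?N J)"
    then have y: "y \<in> space (Pi\<^sub>M J (\<lambda>_. borel :: real measure))" by (simp add: space_PiM)
    have [measurable]: "(\<lambda>u. h (y(k := u))) \<in> borel_measurable borel" by (rule hu[OF y])
    show "H y * ennreal (shift_density \<sigma> J v y)
        = (\<integral>\<^sup>+ u. h (y(k := u)) * ennreal (shift_density \<sigma> (insert k J) v (y(k := u)))
        \<partial>normal_measure \<sigma>)"
      unfolding H_def sd
      by (subst nn_integral_multc[symmetric]) (auto simp: ennreal_mult mult.assoc)
  qed
  also have "\<dots> = (\<integral>\<^sup>+ y. h y * ennreal (shift_density \<sigma> (insert k J) v y) \<partial>?N (insert k J))"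
    by (rule product_nn_integral_insert[OF insert.hyps(1,2), symmetric])
      (use sdm h in \<open>simp cong: measurable_cong_sets add: sets_PiM_normal_measure\<close>)
  finally show ?case .
qed

section \<open>Characteristic functions and unit combinations of normal variables\<close>

lemma normal_measure_eq_distr_std:
  assumes "\<sigma> > 0"
  shows "normal_measure \<sigma> = distr std_normal_distribution borel (\<lambda>x. \<sigma> * x)"
proof -
  interpret prob_space std_normal_distribution by (rule prob_space_normal_density) simp
  have "distributed std_normal_distribution lborel (\<lambda>x. x) (normal_density 0 1)"
    by (auto simp: distributed_def distr_id2 normal_density_nonneg)
  from normal_density_affine[OF this, of \<sigma> 0] assms
  show ?thesis by (simp add: distributed_def cong: distr_cong)
qed

lemma char_normal_measure:
  assumes "\<sigma> > 0"
  shows "char (normal_measure \<sigma>) t = complex_of_real (exp (- (\<sigma> * t)\<^sup>2 / 2))"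
proof -
  have "char (normal_measure \<sigma>) t = char std_normal_distribution (\<sigma> * t)"
    unfolding normal_measure_eq_distr_std[OF assms] char_def
    by (subst integral_distr) (auto simp: mult_ac)
  then show ?thesis by (simp add: char_std_normal_distribution)
qed

text \<open>By independence the characteristic function of the sum is a product, and its exponents
  add up to that of a single variable because \<open>w\<close> is a unit vector. All unit vectors,
  in any dimension, thus give the same law, which is what permits a comparison with dimension
  1.\<close>

lemma distr_normal_linear_combination:
  assumes \<sigma>: "\<sigma> > 0" and J: "finite J" and w: "(\<Sum>j\<in>J. (w j)\<^sup>2) = 1"
  shows "distr (Pi\<^sub>M J (\<lambda>_. normal_measure \<sigma>)) borel (\<lambda>y. \<Sum>j\<in>J. w j * y j) = normal_measure \<sigma>"
    (is "distr ?P _ ?f = _")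
proof (rule Levy_uniqueness)
  interpret product_sigma_finite "\<lambda>_. normal_measure \<sigma>"
    by (rule product_sigma_finite_normal[OF \<sigma>])
  interpret P: prob_space ?P
    by (intro prob_space_PiM prob_space_normal_density \<sigma>)
  interpret nm: prob_space "normal_measure \<sigma>" by (rule prob_space_normal_density[OF \<sigma>])
  have f [measurable]: "?f \<in> borel_measurable ?P" by measurable
  show "real_distribution (distr ?P borel ?f)"
    by (rule P.real_distribution_distr) simp
  show "real_distribution (normal_measure \<sigma>)"
    by unfold_locales auto
  show "char (distr ?P borel ?f) = char (normal_measure \<sigma>)"
  proof
    fix t
    have "char (distr ?P borel ?f) t = (\<integral>y. (\<Prod>j\<in>J. iexp (t * w j * y j)) \<partial>?P)"
      unfolding char_def
      by (subst integral_distr)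
        (auto intro!: Bochner_Integration.integral_cong
          simp: exp_sum[OF J, symmetric] sum_distrib_left mult_ac)
    also have "\<dots> = (\<Prod>j\<in>J. char (normal_measure \<sigma>) (t * w j))"
      unfolding char_def
      by (rule product_integral_prod[OF J], rule nm.integrable_const_bound[where B = 1]) auto
    also have "\<dots> = complex_of_real (exp (\<Sum>j\<in>J. - (\<sigma> * (t * w j))\<^sup>2 / 2))"
      by (simp add: char_normal_measure[OF \<sigma>] exp_sum[OF J])
    also have "(\<Sum>j\<in>J. - (\<sigma> * (t * w j))\<^sup>2 / 2) = (- (\<sigma> * t)\<^sup>2 / 2) * (\<Sum>j\<in>J. (w j)\<^sup>2)"
      by (simp add: sum_distrib_left power_mult_distrib mult_ac sum_divide_distrib sum_negf)
    finally show "char (distr ?P borel ?f) t = char (normal_measure \<sigma>) t"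
      using w by (simp add: char_normal_measure[OF \<sigma>])
  qed
qed


section \<open>Convex comparison of adaptive shifts\<close>

text \<open>
  Jensen's inequality itself is taken as the notion of convexity: it makes sense for functions with
  values in \<open>ennreal\<close>, so that averaging (\<open>jensen_function_average\<close>) needs no integrability condition.
\<close>

definition jensen_function :: "(real \<Rightarrow> ennreal) \<Rightarrow> bool" where
  "jensen_function \<phi> \<longleftrightarrow> \<phi> \<in> borel_measurable borel \<and>
     (\<forall>(M :: real measure) X. prob_space M \<longrightarrow> integrable M X \<longrightarrow>
        \<phi> (\<integral>x. X x \<partial>M) \<le> (\<integral>\<^sup>+ x. \<phi> (X x) \<partial>M))"

lemma jensen_function_measurable: "jensen_function \<phi> \<Longrightarrow> \<phi> \<in> borel_measurable borel"
  by (simp add: jensen_function_def)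

lemma jensen_functionD:
  fixes M :: "real measure"
  shows "jensen_function \<phi> \<Longrightarrow> prob_space M \<Longrightarrow> integrable M X \<Longrightarrow>
    \<phi> (\<integral>x. X x \<partial>M) \<le> (\<integral>\<^sup>+ x. \<phi> (X x) \<partial>M)"
  by (auto simp: jensen_function_def)

text \<open>The usual Jensen inequality covers the case of an integrable composition. Otherwise the
  right-hand side is infinite because \<open>q\<close> is nonnegative. Measurability comes from the
  continuity of finite convex functions on the line.\<close>

lemma jensen_function_convex:
  assumes q: "convex_on UNIV q" "\<And>x. 0 \<le> q x"
  shows "jensen_function (\<lambda>x. ennreal (q x))"
  unfolding jensen_function_def
proof (intro conjI allI impI)
  have "continuous_on UNIV q"
    by (rule convex_on_continuous[OF open_UNIV q(1)])
  then have m [measurable]: "q \<in> borel_measurable borel"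
    by (rule borel_measurable_continuous_onI)
  then show "(\<lambda>x. ennreal (q x)) \<in> borel_measurable borel" by simp
  fix M :: "real measure" and X :: "real \<Rightarrow> real" assume "prob_space M" and X: "integrable M X"
  interpret prob_space M by fact
  have [measurable]: "X \<in> borel_measurable M" using X by simp
  show "ennreal (q (\<integral>x. X x \<partial>M)) \<le> (\<integral>\<^sup>+ x. ennreal (q (X x)) \<partial>M)"
  proof (cases "integrable M (\<lambda>x. q (X x))")
    case True
    have "q (\<integral>x. X x \<partial>M) \<le> (\<integral>x. q (X x) \<partial>M)"
      by (rule jensens_inequality[OF X, of UNIV]) (use True q in auto)
    then show ?thesis
      using True q by (subst nn_integral_eq_integral) (auto intro: ennreal_leI)
  next
    case False
    then have "(\<integral>\<^sup>+ x. ennreal (q (X x)) \<partial>M) = \<infinity>"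
      using q by (auto simp: integrable_iff_bounded not_less top_unique)
    then show ?thesis by simp
  qed
qed

lemma jensen_function_translate:
  assumes "jensen_function \<phi>"
  shows "jensen_function (\<lambda>x. \<phi> (a + x))"
  unfolding jensen_function_def
proof (intro conjI allI impI)
  note [measurable] = jensen_function_measurable[OF assms]
  show "(\<lambda>x. \<phi> (a + x)) \<in> borel_measurable borel" by simp
  fix M :: "real measure" and X :: "real \<Rightarrow> real" assume M: "prob_space M" and X: "integrable M X"
  interpret prob_space M by fact
  have "a + (\<integral>x. X x \<partial>M) = (\<integral>x. a + X x \<partial>M)"
    using X by (subst Bochner_Integration.integral_add) (auto simp: prob_space)
  then show "\<phi> (a + (\<integral>x. X x \<partial>M)) \<le> (\<integral>\<^sup>+ x. \<phi> (a + X x) \<partial>M)"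
    using jensen_functionD[OF assms M, of "\<lambda>x. a + X x"] X by (simp only:) simp
qed

text \<open>Each translate of \<open>\<phi>\<close> satisfies Jensen's inequality, and Fubini
  exchanges the two averages. This absorbs the likelihood ratio of a step into the convex function,
  so that the induction over steps can continue.\<close>

lemma jensen_function_average:
  assumes \<phi>: "jensen_function \<phi>" and "prob_space N" and f [measurable]: "f \<in> borel_measurable N"
  shows "jensen_function (\<lambda>x. \<integral>\<^sup>+ u. \<phi> (x + f u) \<partial>N)"
  unfolding jensen_function_def
proof (intro conjI allI impI)
  interpret N: prob_space N by fact
  note [measurable] = jensen_function_measurable[OF \<phi>]
  show "(\<lambda>x. \<integral>\<^sup>+ u. \<phi> (x + f u) \<partial>N) \<in> borel_measurable borel"
    by measurable
  fix M :: "real measure" and X :: "real \<Rightarrow> real" assume M: "prob_space M" and X: "integrable M X"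
  interpret M: prob_space M by fact
  have [measurable]: "X \<in> borel_measurable M" using X by simp
  interpret pair_sigma_finite M N ..
  have "(\<integral>\<^sup>+ u. \<phi> ((\<integral>x. X x \<partial>M) + f u) \<partial>N) \<le> (\<integral>\<^sup>+ u. \<integral>\<^sup>+ x. \<phi> (X x + f u) \<partial>M \<partial>N)"
  proof (rule nn_integral_mono)
    show "\<phi> ((\<integral>x. X x \<partial>M) + f u) \<le> (\<integral>\<^sup>+ x. \<phi> (X x + f u) \<partial>M)" for u
      using jensen_functionD[OF jensen_function_translate[OF \<phi>, of "f u"] M X]
      by (simp add: add.commute)
  qed
  also have "\<dots> = (\<integral>\<^sup>+ x. \<integral>\<^sup>+ u. \<phi> (X x + f u) \<partial>N \<partial>M)"
    by (rule Fubini') measurable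
  finally show "(\<integral>\<^sup>+ u. \<phi> ((\<integral>x. X x \<partial>M) + f u) \<partial>N) \<le> (\<integral>\<^sup>+ x. \<integral>\<^sup>+ u. \<phi> (X x + f u) \<partial>N \<partial>M)" .
qed

text \<open>The integrand is the density of the normal law with mean \<open>r\<close> relative to
  the centred one; the shift formula for the constant 1 gives its total mass.\<close>

lemma normal_mgf:
  assumes \<sigma>: "\<sigma> > 0"
  shows "integrable (normal_measure \<sigma>) (\<lambda>z. exp ((r * z - r\<^sup>2 / 2) / \<sigma>\<^sup>2))"
    and "(\<integral>z. exp ((r * z - r\<^sup>2 / 2) / \<sigma>\<^sup>2) \<partial>normal_measure \<sigma>) = 1"
proof -
  interpret prob_space "normal_measure \<sigma>" by (rule prob_space_normal_density[OF \<sigma>])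
  have "has_bochner_integral (normal_measure \<sigma>) (\<lambda>z. exp ((r * z - r\<^sup>2 / 2) / \<sigma>\<^sup>2)) 1"
    by (rule has_bochner_integral_nn_integral)
      (use nn_integral_normal_shift[OF \<sigma>, of "\<lambda>_. 1" r] emeasure_space_1 in auto)
  then show "integrable (normal_measure \<sigma>) (\<lambda>z. exp ((r * z - r\<^sup>2 / 2) / \<sigma>\<^sup>2))"
    and "(\<integral>z. exp ((r * z - r\<^sup>2 / 2) / \<sigma>\<^sup>2) \<partial>normal_measure \<sigma>) = 1"
    by (auto simp: has_bochner_integral_iff)
qed

text \<open>
  Adding an independent coordinate with weight \<open>r\<close> completes \<open>v\<close> to a unit vector, for which the
  log-likelihood ratio has the same law as in dimension 1.  Averaging over that coordinate gives back
  the ratio for \<open>v\<close>.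
\<close>

lemma nn_integral_jensen_shift_density_le:
  fixes d :: nat
  assumes \<sigma>: "\<sigma> > 0" and \<phi>: "jensen_function \<phi>" and v: "(\<Sum>j<d. (v j)\<^sup>2) \<le> 1"
  shows "(\<integral>\<^sup>+ y. \<phi> (shift_density \<sigma> {..<d} v y) \<partial>Pi\<^sub>M {..<d} (\<lambda>_. normal_measure \<sigma>))
    \<le> (\<integral>\<^sup>+ z. \<phi> (shift_density \<sigma> {..<1} (\<lambda>_. 1) z) \<partial>Pi\<^sub>M {..<1::nat} (\<lambda>_. normal_measure \<sigma>))"
proof -
  interpret product_sigma_finite "\<lambda>_. normal_measure \<sigma>"
    by (rule product_sigma_finite_normal[OF \<sigma>])
  note nm = prob_space_normal_density[OF \<sigma>, of 0]
  note [measurable] = jensen_function_measurable[OF \<phi>]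
  define r where "r = sqrt (1 - (\<Sum>j<d. (v j)\<^sup>2))"
  have r: "r\<^sup>2 = 1 - (\<Sum>j<d. (v j)\<^sup>2)" using v by (simp add: r_def)
  define w where "w = v(d := r)"
  have w: "(\<Sum>j\<in>{..<Suc d}. (w j)\<^sup>2) = 1"
    using r by (simp add: w_def)
  let ?P = "\<lambda>n. Pi\<^sub>M {..<n::nat} (\<lambda>_. normal_measure \<sigma>)"
  \<comment> \<open>For the unit vector \<open>w\<close> the likelihood ratio depends on the point
    only through the inner product \<open>u\<close>; the constant 1/2 is half the squared norm of
    \<open>w\<close>.\<close>
  let ?g = "\<lambda>u. \<phi> (exp ((u - 1 / 2) / \<sigma>\<^sup>2))"
  have split: "exp (((\<Sum>j\<in>{..<Suc d}. w j * (y(d := z)) j) - 1 / 2) / \<sigma>\<^sup>2)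
      = shift_density \<sigma> {..<d} v y * exp ((r * z - r\<^sup>2 / 2) / \<sigma>\<^sup>2)" for y z
    unfolding shift_density_def mult_exp_exp add_divide_distrib[symmetric]
    by (intro arg_cong[where f = "\<lambda>a. exp (a / \<sigma>\<^sup>2)"]) (simp add: r w_def field_simps)
  have "(\<integral>\<^sup>+ y. \<phi> (shift_density \<sigma> {..<d} v y) \<partial>?P d)
      \<le> (\<integral>\<^sup>+ y. \<integral>\<^sup>+ z. ?g (\<Sum>j\<in>{..<Suc d}. w j * (y(d := z)) j) \<partial>normal_measure \<sigma> \<partial>?P d)"
  proof (rule nn_integral_mono)
    \<comment> \<open>For fixed \<open>y\<close> the extended ratio is the ratio for
      \<open>v\<close> times a factor of mean 1 in \<open>z\<close>, so Jensen's inequality over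
      \<open>z\<close> applies.\<close>
    fix y
    show "\<phi> (shift_density \<sigma> {..<d} v y)
        \<le> (\<integral>\<^sup>+ z. ?g (\<Sum>j\<in>{..<Suc d}. w j * (y(d := z)) j) \<partial>normal_measure \<sigma>)"
      using jensen_functionD[OF \<phi> nm,
          of "\<lambda>z. shift_density \<sigma> {..<d} v y * exp ((r * z - r\<^sup>2 / 2) / \<sigma>\<^sup>2)"]
      unfolding split by (simp add: normal_mgf[OF \<sigma>])
  qed
  also have "\<dots> = (\<integral>\<^sup>+ y. ?g (\<Sum>j\<in>{..<Suc d}. w j * y j) \<partial>?P (Suc d))"
    unfolding lessThan_Suc by (subst product_nn_integral_insert) auto
  also have "\<dots> = (\<integral>\<^sup>+ u. ?g u \<partial>distr (?P (Suc d)) borel (\<lambda>y. \<Sum>j\<in>{..<Suc d}. w j * y j))"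
    by (subst nn_integral_distr) auto
  \<comment> \<open>Both inner products have unit weights, in dimension \<open>Suc d\<close> and in
    dimension 1, and therefore the same normal law.\<close>
  also have "\<dots> = (\<integral>\<^sup>+ u. ?g u \<partial>distr (?P 1) borel (\<lambda>z. \<Sum>j\<in>{..<1::nat}. 1 * z j))"
    by (subst (1 2) distr_normal_linear_combination[OF \<sigma>]) (use w in auto)
  also have "\<dots> = (\<integral>\<^sup>+ z. \<phi> (shift_density \<sigma> {..<1} (\<lambda>_. 1) z) \<partial>?P 1)"
    by (subst nn_integral_distr) (auto simp: shift_density_def)
  finally show ?thesis .
qed

section \<open>Shifting the noise of one among several steps\<close>

abbreviation noise :: "nat \<Rightarrow> nat \<Rightarrow> real \<Rightarrow> (nat \<Rightarrow> nat \<Rightarrow> real) measure" where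
  "noise T d \<sigma> \<equiv> Pi\<^sub>M {..<T} (\<lambda>_. gaussian_noise d \<sigma>)"

abbreviation outputs :: "nat \<Rightarrow> nat \<Rightarrow> (nat \<Rightarrow> nat \<Rightarrow> real) measure" where
  "outputs T d \<equiv> Pi\<^sub>M {..<T} (\<lambda>_. rvec d)"

declare sets_gaussian_noise [measurable_cong]

lemma sets_PiM_gaussian_noise [measurable_cong]:
  "sets (Pi\<^sub>M I (\<lambda>_. gaussian_noise d \<sigma>)) = sets (Pi\<^sub>M I (\<lambda>_. rvec d))"
  by (intro sets_PiM_cong) (auto simp: sets_gaussian_noise)

lemma product_sigma_finite_gaussian_noise:
  "\<sigma> > 0 \<Longrightarrow> product_sigma_finite (\<lambda>_. gaussian_noise d \<sigma>)"
  unfolding product_sigma_finite_def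
  by (intro allI prob_space_imp_sigma_finite prob_space_gaussian_noise)

lemma prob_space_noise: "\<sigma> > 0 \<Longrightarrow> prob_space (noise T d \<sigma>)"
  by (intro prob_space_PiM prob_space_gaussian_noise)

lemma measurable_coordinate:
  assumes "t \<in> I" "j < d"
  shows "(\<lambda>\<xi>. \<xi> t j) \<in> borel_measurable (Pi\<^sub>M I (\<lambda>_. rvec d))"
  using measurable_compose[OF measurable_component_singleton[of t I "\<lambda>_. rvec d"]
      measurable_component_singleton[of j "{..<d}" "\<lambda>_. borel"]] assms by simp

lemma measurable_rvec_coordinate:
  assumes "v \<in> M \<rightarrow>\<^sub>M rvec d" "j < d"
  shows "(\<lambda>\<xi>. v \<xi> j) \<in> borel_measurable M"
  using measurable_compose[OF assms(1) measurable_component_singleton[of j "{..<d}" "\<lambda>_. borel"]]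
      assms(2)
  by simp

lemma measurable_shift_density:
  assumes "v \<in> M \<rightarrow>\<^sub>M rvec d" "u \<in> M \<rightarrow>\<^sub>M rvec d"
  shows "(\<lambda>\<xi>. shift_density \<sigma> {..<d} (v \<xi>) (u \<xi>)) \<in> borel_measurable M"
  unfolding shift_density_def
  using measurable_rvec_coordinate[OF assms(1)] measurable_rvec_coordinate[OF assms(2)]
  by (intro measurable_compose[OF _ borel_measurable_exp] borel_measurable_divide
      borel_measurable_diff borel_measurable_sum borel_measurable_times borel_measurable_power
      borel_measurable_const) auto

text \<open>The shift may depend on all noise except that of step \<open>s\<close>. Once the other
  steps are fixed it is a constant vector, so Fubini reduces the claim to the Gaussian shift formula
  in step \<open>s\<close>.\<close>

lemma nn_integral_noise_shift:
  assumes \<sigma>: "\<sigma> > 0" and s: "s < T"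
    and h [measurable]: "h \<in> borel_measurable (outputs T d)"
    and v [measurable]: "v \<in> outputs T d \<rightarrow>\<^sub>M rvec d"
    and indep: "\<And>\<xi> y. v (\<xi>(s := y)) = v \<xi>"
  shows "(\<integral>\<^sup>+ \<xi>. h (\<xi>(s := \<lambda>j\<in>{..<d}. \<xi> s j + v \<xi> j)) \<partial>noise T d \<sigma>)
    = (\<integral>\<^sup>+ \<xi>. h \<xi> * ennreal (shift_density \<sigma> {..<d} (v \<xi>) (\<xi> s)) \<partial>noise T d \<sigma>)"
proof -
  interpret product_sigma_finite "\<lambda>_. gaussian_noise d \<sigma>"
    by (rule product_sigma_finite_gaussian_noise[OF \<sigma>])
  define I where "I = {..<T} - {s}"
  have I: "finite I" "s \<notin> I" and T: "{..<T} = insert s I"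
    using s by (auto simp: I_def)
  have sm [measurable]: "(\<lambda>\<xi>. \<xi> s) \<in> outputs T d \<rightarrow>\<^sub>M rvec d"
    using s by simp
  have upd: "(\<lambda>\<xi>. \<xi>(s := \<lambda>j\<in>{..<d}. \<xi> s j + v \<xi> j)) \<in> outputs T d \<rightarrow>\<^sub>M outputs T d"
    by (rule measurable_fun_upd[where J = "{..<T}"])
      (use s in \<open>auto intro!: measurable_restrict borel_measurable_add
        measurable_rvec_coordinate[OF v] measurable_coordinate\<close>)
  have m1: "(\<lambda>\<xi>. h (\<xi>(s := \<lambda>j\<in>{..<d}. \<xi> s j + v \<xi> j)))
      \<in> borel_measurable (Pi\<^sub>M (insert s I) (\<lambda>_. gaussian_noise d \<sigma>))"
    using measurable_compose[OF upd h] unfolding T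
    by (simp cong: measurable_cong_sets add: sets_PiM_gaussian_noise)
  have m2: "(\<lambda>\<xi>. h \<xi> * ennreal (shift_density \<sigma> {..<d} (v \<xi>) (\<xi> s)))
      \<in> borel_measurable (Pi\<^sub>M (insert s I) (\<lambda>_. gaussian_noise d \<sigma>))"
    using measurable_shift_density[OF v sm] h unfolding T
    by (simp cong: measurable_cong_sets add: sets_PiM_gaussian_noise)
  have inner: "(\<integral>\<^sup>+ y. h (\<xi>(s := \<lambda>j\<in>{..<d}. y j + v \<xi> j)) \<partial>gaussian_noise d \<sigma>)
      = (\<integral>\<^sup>+ y. h (\<xi>(s := y)) * ennreal (shift_density \<sigma> {..<d} (v \<xi>) y) \<partial>gaussian_noise d \<sigma>)"
    if "\<xi> \<in> space (Pi\<^sub>M I (\<lambda>_. gaussian_noise d \<sigma>))" for \<xi>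
  proof -
    have "\<xi> \<in> space (Pi\<^sub>M I (\<lambda>_. rvec d))"
      using that by (metis sets_PiM_gaussian_noise sets_eq_imp_space_eq)
    from measurable_compose[OF measurable_component_update[OF this I(2)] h[unfolded T]]
    show ?thesis
      unfolding gaussian_noise_def
      by (intro nn_integral_PiM_normal_shift[OF \<sigma>]) auto
  qed
  have "(\<integral>\<^sup>+ \<xi>. h (\<xi>(s := \<lambda>j\<in>{..<d}. \<xi> s j + v \<xi> j)) \<partial>noise T d \<sigma>)
     = (\<integral>\<^sup>+ \<xi>. \<integral>\<^sup>+ y. h (\<xi>(s := \<lambda>j\<in>{..<d}. y j + v \<xi> j)) \<partial>gaussian_noise d \<sigma>
         \<partial>Pi\<^sub>M I (\<lambda>_. gaussian_noise d \<sigma>))"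
    unfolding T by (subst product_nn_integral_insert[OF I m1]) (simp add: indep)
  also have "\<dots> = (\<integral>\<^sup>+ \<xi>. \<integral>\<^sup>+ y. h (\<xi>(s := y)) * ennreal (shift_density \<sigma> {..<d} (v \<xi>) y)
      \<partial>gaussian_noise d \<sigma> \<partial>Pi\<^sub>M I (\<lambda>_. gaussian_noise d \<sigma>))"
    by (intro nn_integral_cong inner)
  also have "\<dots> = (\<integral>\<^sup>+ \<xi>. h \<xi> * ennreal (shift_density \<sigma> {..<d} (v \<xi>) (\<xi> s)) \<partial>noise T d \<sigma>)"
    unfolding T by (subst product_nn_integral_insert[OF I m2]) (simp add: indep)
  finally show ?thesis .
qed

text \<open>Induction on the number of steps, peeling off the last one. With the earlier noise
  fixed, the earlier ratios are a constant and \<open>v n\<close> is a constant vector of norm at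
  most 1, so the single-step comparison applies to a translate of \<open>\<phi>\<close>. Averaging
  over the one-dimensional ratio gives \<open>\<phi>'\<close>, which again satisfies Jensen's
  inequality. Since the number of steps decreases in the induction, \<open>v t\<close> is taken to
  be measurable on \<open>outputs n d\<close> for every \<open>n \<ge> t\<close>.\<close>

lemma nn_integral_jensen_adaptive_le:
  assumes \<sigma>: "\<sigma> > 0" and \<phi>: "jensen_function \<phi>"
    and v: "\<And>t n. t \<le> n \<Longrightarrow> v t \<in> outputs n d \<rightarrow>\<^sub>M rvec d"
    and norm: "\<And>t \<xi>. (\<Sum>j<d. (v t \<xi> j)\<^sup>2) \<le> 1"
    and indep: "\<And>t s \<xi> y. t \<le> s \<Longrightarrow> v t (\<xi>(s := y)) = v t \<xi>"
  shows "(\<integral>\<^sup>+ \<xi>. \<phi> (\<Sum>t<n. shift_density \<sigma> {..<d} (v t \<xi>) (\<xi> t)) \<partial>noise n d \<sigma>)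
    \<le> (\<integral>\<^sup>+ \<zeta>. \<phi> (\<Sum>t<n. shift_density \<sigma> {..<1} (\<lambda>_. 1) (\<zeta> t)) \<partial>noise n 1 \<sigma>)"
  using \<phi>
proof (induction n arbitrary: \<phi>)
  case 0
  show ?case
    using prob_space.emeasure_space_1[OF prob_space_noise[OF \<sigma>, of 0]]
    by (simp add: nn_integral_const)
next
  case (Suc n)
  note \<phi> = Suc.prems
  note \<phi>m [measurable] = jensen_function_measurable[OF \<phi>]
  interpret A: product_sigma_finite "\<lambda>_. gaussian_noise d \<sigma>"
    by (rule product_sigma_finite_gaussian_noise[OF \<sigma>])
  interpret B: product_sigma_finite "\<lambda>_. gaussian_noise 1 \<sigma>"
    by (rule product_sigma_finite_gaussian_noise[OF \<sigma>])
  let ?l = "\<lambda>z. shift_density \<sigma> {..<1::nat} (\<lambda>_. 1) z"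
  define \<phi>' where "\<phi>' a = (\<integral>\<^sup>+ z. \<phi> (a + ?l z) \<partial>gaussian_noise 1 \<sigma>)" for a
  have l: "?l \<in> borel_measurable (gaussian_noise 1 \<sigma>)"
    unfolding shift_density_def gaussian_noise_def by measurable
  have \<phi>': "jensen_function \<phi>'"
    unfolding \<phi>'_def by (rule jensen_function_average[OF \<phi> prob_space_gaussian_noise[OF \<sigma>] l])
  have m: "(\<lambda>\<xi>. \<phi> (\<Sum>t<Suc n. shift_density \<sigma> {..<d} (v t \<xi>) (\<xi> t)))
      \<in> borel_measurable (Pi\<^sub>M (insert n {..<n}) (\<lambda>_. gaussian_noise d \<sigma>))"
  proof -
    have "(\<lambda>\<xi>. \<phi> (\<Sum>t<Suc n. shift_density \<sigma> {..<d} (v t \<xi>) (\<xi> t)))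
        \<in> borel_measurable (outputs (Suc n) d)"
      by (rule measurable_compose[OF _ \<phi>m], rule borel_measurable_sum, rule measurable_shift_density)
        (auto intro!: v measurable_component_singleton)
    then show ?thesis
      by (simp cong: measurable_cong_sets add: sets_PiM_gaussian_noise lessThan_Suc)
  qed
  have m1: "(\<lambda>\<zeta>. \<phi> (\<Sum>t<Suc n. ?l (\<zeta> t)))
      \<in> borel_measurable (Pi\<^sub>M (insert n {..<n}) (\<lambda>_. gaussian_noise 1 \<sigma>))"
    by (rule measurable_compose[OF _ \<phi>m], rule borel_measurable_sum, rule measurable_compose[OF _ l])
      (auto intro!: measurable_component_singleton)
  have sumd: "(\<Sum>t<Suc n. shift_density \<sigma> {..<d} (v t (\<xi>(n := y))) ((\<xi>(n := y)) t))
      = (\<Sum>t<n. shift_density \<sigma> {..<d} (v t \<xi>) (\<xi> t)) + shift_density \<sigma> {..<d} (v n \<xi>) y" for \<xi> y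
    by (simp add: indep)
  have "(\<integral>\<^sup>+ \<xi>. \<phi> (\<Sum>t<Suc n. shift_density \<sigma> {..<d} (v t \<xi>) (\<xi> t)) \<partial>noise (Suc n) d \<sigma>)
     = (\<integral>\<^sup>+ \<xi>. \<integral>\<^sup>+ y. \<phi> ((\<Sum>t<n. shift_density \<sigma> {..<d} (v t \<xi>) (\<xi> t))
         + shift_density \<sigma> {..<d} (v n \<xi>) y) \<partial>gaussian_noise d \<sigma> \<partial>noise n d \<sigma>)"
    unfolding sumd[symmetric] using A.product_nn_integral_insert[OF _ _ m] by (simp add: lessThan_Suc)
  also have "\<dots> \<le> (\<integral>\<^sup>+ \<xi>. \<phi>' (\<Sum>t<n. shift_density \<sigma> {..<d} (v t \<xi>) (\<xi> t)) \<partial>noise n d \<sigma>)"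
    unfolding \<phi>'_def gaussian_noise_def
    by (intro nn_integral_mono nn_integral_jensen_shift_density_le[OF \<sigma>]
        jensen_function_translate \<phi> norm)
  also have "\<dots> \<le> (\<integral>\<^sup>+ \<zeta>. \<phi>' (\<Sum>t<n. ?l (\<zeta> t)) \<partial>noise n 1 \<sigma>)"
    by (rule Suc.IH[OF \<phi>'])
  also have "\<dots> = (\<integral>\<^sup>+ \<zeta>. \<phi> (\<Sum>t<Suc n. ?l (\<zeta> t)) \<partial>noise (Suc n) 1 \<sigma>)"
    unfolding \<phi>'_def using B.product_nn_integral_insert[OF _ _ m1]
    by (simp add: lessThan_Suc add.commute)
  finally show ?case .
qed


section \<open>The effect of one record on the mechanism\<close>

lemma answers_cong:
  "(\<And>s. s < t \<Longrightarrow> \<xi> s = \<xi>' s) \<Longrightarrow> answers d A S x \<xi> t = answers d A S x \<xi>' t"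
  by (induction t) auto

lemma answers_in_lists: "answers d A S x \<xi> t \<in> lists (space (rvec d))"
  by (induction t) (auto simp: space_PiM)

lemma query_answers_measurable:
  assumes A: "adaptive_query_method d A" and t: "t \<le> T"
  shows "(\<lambda>\<xi>. A (answers d A S x \<xi> t) y) \<in> Pi\<^sub>M {..<T} (\<lambda>_. rvec d) \<rightarrow>\<^sub>M rvec d"
proof -
  let ?f = "\<lambda>\<xi>. \<lambda>s\<in>{..<t}. answers d A S x \<xi> t ! s"
  have ans: "answers d A S x \<xi> t = map (?f \<xi>) [0..<t]" for \<xi>
    by (rule nth_equalityI) auto
  have "(\<lambda>g. A (map g [0..<t]) y) \<in> Pi\<^sub>M {..<t} (\<lambda>_. rvec d) \<rightarrow>\<^sub>M rvec d"
    using A unfolding adaptive_query_method_def by blast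
  from measurable_compose[OF answers_measurable[OF A t, of S x] this] show ?thesis
    by (simp only: ans[symmetric])
qed

lemma query_answers_norm:
  assumes "adaptive_query_method d A"
  shows "(\<Sum>j<d. (A (answers d A S x \<xi> t) y j)\<^sup>2) \<le> 1"
proof -
  have "L2_set (A (answers d A S x \<xi> t) y) {..<d} \<le> 1"
    using assms answers_in_lists unfolding adaptive_query_method_def by blast
  then show ?thesis by (simp add: L2_set_def)
qed

text \<open>A null record adds the zero vector to every sum, so the answers do not depend on its
  batch. All placements of the differing record can therefore be compared with one and the same
  reference run.\<close>

lemma answers_null_record:
  assumes "x ! i = None"
    and "\<And>t. t < T \<Longrightarrow> finite (S ! t)" "\<And>t. t < T \<Longrightarrow> S' ! t - {i} = S ! t - {i}"
    and "t \<le> T"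
  shows "answers d A S' x \<xi> t = answers d A S x \<xi> t"
  using \<open>t \<le> T\<close>
proof (induction t)
  case (Suc t)
  then have t: "t < T" by simp
  have IH: "answers d A S' x \<xi> t = answers d A S x \<xi> t" (is "_ = ?gs")
    by (rule Suc.IH) (use Suc.prems in simp)
  have "finite (S' ! t)"
    using assms(2,3)[OF t] by (metis finite_Diff finite_insert finite_Diff2 finite.emptyI)
  have *: "(\<Sum>k\<in>B. extended_query d A ?gs (x ! k) j) = (\<Sum>k\<in>B - {i}. extended_query d A ?gs (x ! k) j)"
    if "finite B" "j < d" for B j
    using that assms(1) by (cases "i \<in> B") (auto simp: sum.remove)
  show ?case
    using *[OF assms(2)[OF t]] *[OF \<open>finite (S' ! t)\<close>] assms(3)[OF t]
    by (auto simp: IH intro!: restrict_ext)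
qed simp

text \<open>The record enters in step \<open>s\<close> only, where its contribution can be counted
  as extra noise. The query producing it sees only answers before step \<open>s\<close>, which do
  not involve the altered noise; from then on the two runs have equal answers.\<close>

lemma answers_record_shift:
  assumes y: "x ! i = Some y" "x' ! i = None"
    and x: "\<And>t k. t < T \<Longrightarrow> k \<in> S ! t \<Longrightarrow> k \<noteq> i \<Longrightarrow> x ! k = x' ! k"
    and S: "\<And>t. t < T \<Longrightarrow> finite (S ! t)" "\<And>t. t < T \<Longrightarrow> i \<in> S ! t \<longleftrightarrow> t = s"
    and t: "t \<le> T"
  shows "answers d A S x \<xi> t
    = answers d A S x' (\<xi>(s := \<lambda>j\<in>{..<d}. \<xi> s j + A (answers d A S x' \<xi> s) y j)) t"
    (is "_ = answers d A S x' ?\<xi> t")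
  using t
proof (induction t)
  case (Suc t)
  then have t: "t < T" by simp
  have IH: "answers d A S x \<xi> t = answers d A S x' ?\<xi> t" (is "?gs = _")
    by (rule Suc.IH) (use Suc.prems in simp)
  let ?q = "\<lambda>r j. extended_query d A ?gs r j"
  have rest: "(\<Sum>k\<in>S ! t - {i}. ?q (x ! k) j) = (\<Sum>k\<in>S ! t - {i}. ?q (x' ! k) j)" for j
    using x[OF t] by (intro sum.cong) auto
  have step: ?case
    if "\<And>j. j < d \<Longrightarrow> (\<Sum>k\<in>S ! t. ?q (x ! k) j) + \<xi> t j = (\<Sum>k\<in>S ! t. ?q (x' ! k) j) + ?\<xi> t j"
  proof -
    have "(\<lambda>j\<in>{..<d}. (\<Sum>k\<in>S ! t. ?q (x ! k) j) + \<xi> t j)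
        = (\<lambda>j\<in>{..<d}. (\<Sum>k\<in>S ! t. ?q (x' ! k) j) + ?\<xi> t j)"
      by (rule restrict_ext) (use that in blast)
    then show ?thesis
      unfolding answers.simps IH[symmetric] by (rule arg_cong[where f = "\<lambda>v. ?gs @ [v]"])
  qed
  show ?case
  proof (cases "t = s")
    case True
    then have i: "i \<in> S ! t" using S(2)[OF t] by simp
    \<comment> \<open>The first \<open>s\<close> answers use only the noise of steps before
      \<open>s\<close>, so the update at \<open>s\<close> does not reach them.\<close>
    have gs: "?gs = answers d A S x' \<xi> s"
      unfolding IH unfolding True by (rule answers_cong) auto
    show ?thesis
    proof (rule step)
      fix j assume "j < d"
      then show "(\<Sum>k\<in>S ! t. ?q (x ! k) j) + \<xi> t j = (\<Sum>k\<in>S ! t. ?q (x' ! k) j) + ?\<xi> t j"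
        using rest[of j] y True sum.remove[OF S(1)[OF t] i, of "\<lambda>k. ?q (x ! k) j"]
          sum.remove[OF S(1)[OF t] i, of "\<lambda>k. ?q (x' ! k) j"]
        by (simp add: gs[unfolded True])
    qed
  next
    case False
    then have "S ! t - {i} = S ! t" using S(2)[OF t] by simp
    then show ?thesis
      using rest False by (intro step) simp
  qed
qed simp

section \<open>Output probabilities as integrals over the noise\<close>

lemma has_bochner_integral_ablq_given:
  assumes \<sigma>: "\<sigma> > 0" and A: "adaptive_query_method d A" and E: "E \<in> sets (outputs T d)"
  shows "has_bochner_integral (noise T d \<sigma>)
    (\<lambda>\<xi>. indicator E (\<lambda>t\<in>{..<T}. answers d A S x \<xi> T ! t)) (measure (ablq_given d \<sigma> T A x S) E)"
    (is "has_bochner_integral _ (\<lambda>\<xi>. indicator E (?F \<xi>)) _")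
proof -
  interpret prob_space "noise T d \<sigma>" by (rule prob_space_noise[OF \<sigma>])
  note F [measurable] = ablq_given_measurable[OF A, where T = T and S = S and x = x and \<sigma> = \<sigma>]
  have "measure (ablq_given d \<sigma> T A x S) E = measure (noise T d \<sigma>) (?F -` E \<inter> space (noise T d \<sigma>))"
    unfolding ablq_given_def by (rule measure_distr[OF F E])
  moreover have "has_bochner_integral (noise T d \<sigma>) (indicator (?F -` E \<inter> space (noise T d \<sigma>))
        :: _ \<Rightarrow> real)
      (measure (noise T d \<sigma>) (?F -` E \<inter> space (noise T d \<sigma>)))"
    using measurable_sets[OF F E]
    by (intro has_bochner_integral_real_indicator) (auto simp: emeasure_eq_measure)
  ultimately show ?thesis
    by (simp add: indicator_def cong: has_bochner_integral_cong)
qed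

text \<open>Transfers the shift formula to real integrals: \<open>h\<close> is nonnegative, so
  finiteness of the shifted integral yields integrability of the weighted one.\<close>

lemma has_bochner_integral_noise_shift:
  assumes \<sigma>: "\<sigma> > 0" and s: "s < T"
    and h: "h \<in> borel_measurable (outputs T d)" and h0: "\<And>\<xi>. 0 \<le> h \<xi>"
    and v: "v \<in> outputs T d \<rightarrow>\<^sub>M rvec d"
    and indep: "\<And>\<xi> y. v (\<xi>(s := y)) = v \<xi>"
    and I: "has_bochner_integral (noise T d \<sigma>) (\<lambda>\<xi>. h (\<xi>(s := \<lambda>j\<in>{..<d}. \<xi> s j + v \<xi> j))) c"
  shows "has_bochner_integral (noise T d \<sigma>) (\<lambda>\<xi>. h \<xi> * shift_density \<sigma> {..<d} (v \<xi>) (\<xi> s)) c"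
proof (rule has_bochner_integral_nn_integral)
  have "(\<lambda>\<xi>. h \<xi> * shift_density \<sigma> {..<d} (v \<xi>) (\<xi> s)) \<in> borel_measurable (outputs T d)"
    using s by (intro borel_measurable_times h measurable_shift_density v) simp
  then show "(\<lambda>\<xi>. h \<xi> * shift_density \<sigma> {..<d} (v \<xi>) (\<xi> s)) \<in> borel_measurable (noise T d \<sigma>)"
    by (simp cong: measurable_cong_sets add: sets_PiM_gaussian_noise)
  have c: "c = (\<integral>\<xi>. h (\<xi>(s := \<lambda>j\<in>{..<d}. \<xi> s j + v \<xi> j)) \<partial>noise T d \<sigma>)"
    using I by (simp add: has_bochner_integral_iff)
  then show "0 \<le> c" using h0 by simp
  have "(\<integral>\<^sup>+ \<xi>. ennreal (h \<xi> * shift_density \<sigma> {..<d} (v \<xi>) (\<xi> s)) \<partial>noise T d \<sigma>)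
     = (\<integral>\<^sup>+ \<xi>. ennreal (h (\<xi>(s := \<lambda>j\<in>{..<d}. \<xi> s j + v \<xi> j))) \<partial>noise T d \<sigma>)"
    using nn_integral_noise_shift[OF \<sigma> s measurable_compose[OF h measurable_ennreal] v indep]
    by (simp add: ennreal_mult h0)
  also have "\<dots> = ennreal c"
    using I h0 by (subst nn_integral_eq_integral) (auto simp: has_bochner_integral_iff)
  finally show "(\<integral>\<^sup>+ \<xi>. ennreal (h \<xi> * shift_density \<sigma> {..<d} (v \<xi>) (\<xi> s)) \<partial>noise T d \<sigma>)
      = ennreal c" .
qed (auto simp: h0)

text \<open>The change of measure takes place on the noise space. There the run without the record
  serves as reference, and inserting the record into batch \<open>s\<close> amounts to a weight by
  the likelihood ratio of step \<open>s\<close>.\<close>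

lemma has_bochner_integral_ablq_given_shift:
  assumes \<sigma>: "\<sigma> > 0" and A: "adaptive_query_method d A" and E: "E \<in> sets (outputs T d)"
    and s: "s < T"
    and y: "x ! i = Some y" "x' ! i = None"
    and x: "\<And>t k. t < T \<Longrightarrow> k \<in> S ! t \<Longrightarrow> k \<noteq> i \<Longrightarrow> x ! k = x' ! k"
    and S: "\<And>t. t < T \<Longrightarrow> finite (S ! t)" "\<And>t. t < T \<Longrightarrow> i \<in> S ! t \<longleftrightarrow> t = s"
  shows "has_bochner_integral (noise T d \<sigma>)
    (\<lambda>\<xi>. indicator E (\<lambda>t\<in>{..<T}. answers d A S x' \<xi> T ! t) *
      shift_density \<sigma> {..<d} (A (answers d A S x' \<xi> s) y) (\<xi> s))
    (measure (ablq_given d \<sigma> T A x S) E)"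
proof (rule has_bochner_integral_noise_shift[OF \<sigma> s])
  show "(\<lambda>\<xi>. indicator E (\<lambda>t\<in>{..<T}. answers d A S x' \<xi> T ! t) :: real)
      \<in> borel_measurable (outputs T d)"
    using E by (intro measurable_compose[OF answers_measurable[OF A order_refl]]) simp
  show "(\<lambda>\<xi>. A (answers d A S x' \<xi> s) y) \<in> outputs T d \<rightarrow>\<^sub>M rvec d"
    using query_answers_measurable[OF A] s by simp
  show "A (answers d A S x' (\<xi>(s := z)) s) y = A (answers d A S x' \<xi> s) y" for \<xi> z
    by (simp cong: answers_cong)
  show "has_bochner_integral (noise T d \<sigma>)
     (\<lambda>\<xi>. indicator E (\<lambda>t\<in>{..<T}. answers d A S x'
        (\<xi>(s := \<lambda>j\<in>{..<d}. \<xi> s j + A (answers d A S x' \<xi> s) y j)) T ! t))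
     (measure (ablq_given d \<sigma> T A x S) E)"
  proof -
    have "answers d A S x \<xi> T
        = answers d A S x' (\<xi>(s := \<lambda>j\<in>{..<d}. \<xi> s j + A (answers d A S x' \<xi> s) y j)) T" for \<xi>
      by (rule answers_record_shift[OF y x S order_refl])
    from has_bochner_integral_ablq_given[OF \<sigma> A E, of S x, unfolded this] show ?thesis .
  qed
qed simp

text \<open>
  The coefficients \<open>1 / T, - exp \<epsilon>\<close> and \<open>- exp \<epsilon> / T, 1\<close> give the two directions of the adjacency.
\<close>

definition hockey_stick :: "nat \<Rightarrow> real \<Rightarrow> real \<Rightarrow> real \<Rightarrow> real" where
  "hockey_stick T \<sigma> a c =
     (\<integral>\<zeta>. max 0 (a * (\<Sum>t<T. shift_density \<sigma> {..<1} (\<lambda>_. 1) (\<zeta> t)) + c) \<partial>noise T 1 \<sigma>)"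

text \<open>The shift formula for the constant 1: the likelihood ratio has total mass 1.\<close>

lemma integrable_noise_shift_density:
  assumes \<sigma>: "\<sigma> > 0" and s: "s < T"
    and v: "v \<in> outputs T d \<rightarrow>\<^sub>M rvec d"
    and indep: "\<And>\<xi> y. v (\<xi>(s := y)) = v \<xi>"
  shows "integrable (noise T d \<sigma>) (\<lambda>\<xi>. shift_density \<sigma> {..<d} (v \<xi>) (\<xi> s))"
proof -
  interpret prob_space "noise T d \<sigma>" by (rule prob_space_noise[OF \<sigma>])
  have "has_bochner_integral (noise T d \<sigma>) (\<lambda>_. 1 :: real) 1"
    by (simp add: has_bochner_integral_iff prob_space)
  from has_bochner_integral_noise_shift[OF \<sigma> s _ _ v indep, of "\<lambda>_. 1", OF _ _ this] show ?thesis
    by (simp add: has_bochner_integral_iff)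
qed

text \<open>Elements of \<open>rvec 1\<close> are \<open>undefined\<close> beyond coordinate 0, so
  the constant query has to be restricted; the density reads only coordinate 0.\<close>

lemma shift_density_one_cong:
  "shift_density \<sigma> {..<1::nat} (\<lambda>_. 1) = shift_density \<sigma> {..<1} (\<lambda>j\<in>{..<1}. 1)"
  by (simp add: shift_density_def fun_eq_iff)

lemma integrable_shift_density_one:
  assumes "\<sigma> > 0" "t < T"
  shows "integrable (noise T 1 \<sigma>) (\<lambda>\<zeta>. shift_density \<sigma> {..<1} (\<lambda>_. 1) (\<zeta> t))"
  unfolding shift_density_one_cong
  by (rule integrable_noise_shift_density[OF assms]) (auto simp: space_PiM)

lemma integrable_max_0: "integrable M f \<Longrightarrow> integrable M (\<lambda>x. max 0 (f x :: real))"
  by (rule integrable_max) auto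

lemma convex_on_max_0_affine: "convex_on UNIV (\<lambda>x::real. max 0 (a * x + c))"
proof (rule convex_onI)
  fix t x y :: real assume t: "0 < t" "t < 1"
  have "a * ((1 - t) *\<^sub>R x + t *\<^sub>R y) + c = (1 - t) * (a * x + c) + t * (a * y + c)"
    by (simp add: algebra_simps)
  also have "\<dots> \<le> (1 - t) * max 0 (a * x + c) + t * max 0 (a * y + c)"
    using t by (intro add_mono mult_left_mono) auto
  finally show "max 0 (a * ((1 - t) *\<^sub>R x + t *\<^sub>R y) + c)
      \<le> (1 - t) * max 0 (a * x + c) + t * max 0 (a * y + c)"
    using t by simp
qed simp

text \<open>The batches \<open>S s\<close> put record \<open>i\<close> into batch \<open>s\<close>
  and agree with \<open>S'\<close> on all other records, so every run on \<open>x'\<close> coincides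
  with the one for \<open>S'\<close>. Over the noise the left-hand side is then the integral of the
  indicator of the event times an affine function of the summed ratios. It is at most the integral
  of the positive part, a convex function of that sum, to which the adaptive comparison
  applies.\<close>

lemma ablq_given_gap_le_hockey_stick:
  assumes \<sigma>: "\<sigma> > 0" and A: "adaptive_query_method d A" and E: "E \<in> sets (outputs T d)"
    and y: "x ! i = Some y" "x' ! i = None"
    and x: "\<And>s t k. s < T \<Longrightarrow> t < T \<Longrightarrow> k \<in> S s ! t \<Longrightarrow> k \<noteq> i \<Longrightarrow> x ! k = x' ! k"
    and S: "\<And>s t. s < T \<Longrightarrow> t < T \<Longrightarrow> finite (S s ! t)"
      "\<And>s t. s < T \<Longrightarrow> t < T \<Longrightarrow> i \<in> S s ! t \<longleftrightarrow> t = s"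
    and S': "\<And>t. t < T \<Longrightarrow> finite (S' ! t)" "\<And>s t. s < T \<Longrightarrow> t < T \<Longrightarrow> S s ! t - {i} = S' ! t - {i}"
  shows "a * (\<Sum>s<T. measure (ablq_given d \<sigma> T A x (S s)) E) + c * measure (ablq_given d \<sigma> T A x' S') E
    \<le> hockey_stick T \<sigma> a c"
proof -
  interpret prob_space "noise T d \<sigma>" by (rule prob_space_noise[OF \<sigma>])
  interpret N1: prob_space "noise T 1 \<sigma>" by (rule prob_space_noise[OF \<sigma>])
  let ?F = "\<lambda>\<xi>. \<lambda>t\<in>{..<T}. answers d A S' x' \<xi> T ! t"
  define v where "v = (\<lambda>t \<xi>. A (answers d A S' x' \<xi> t) y)"
  have v: "v t \<in> outputs n d \<rightarrow>\<^sub>M rvec d" if "t \<le> n" for t n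
    unfolding v_def by (rule query_answers_measurable[OF A that])
  have norm: "(\<Sum>j<d. (v t \<xi> j)\<^sup>2) \<le> 1" for t \<xi>
    unfolding v_def by (rule query_answers_norm[OF A])
  have indep: "v t (\<xi>(s := z)) = v t \<xi>" if "t \<le> s" for t s \<xi> z
    using that unfolding v_def by (simp cong: answers_cong)
  let ?L = "\<lambda>\<xi>. \<Sum>t<T. shift_density \<sigma> {..<d} (v t \<xi>) (\<xi> t)"
  let ?L1 = "\<lambda>\<zeta>. \<Sum>t<T. shift_density \<sigma> {..<1::nat} (\<lambda>_. 1) (\<zeta> t)"
  have L: "integrable (noise T d \<sigma>) ?L"
    using v indep
    by (intro Bochner_Integration.integrable_sum integrable_noise_shift_density[OF \<sigma>]) auto
  have L1: "integrable (noise T 1 \<sigma>) ?L1"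
    by (intro Bochner_Integration.integrable_sum integrable_shift_density_one[OF \<sigma>]) auto
  have "has_bochner_integral (noise T d \<sigma>)
      (\<lambda>\<xi>. indicator E (?F \<xi>) * shift_density \<sigma> {..<d} (v s \<xi>) (\<xi> s))
          (measure (ablq_given d \<sigma> T A x (S s)) E)"
    if s: "s < T" for s
  proof -
    have "answers d A (S s) x' \<xi> t = answers d A S' x' \<xi> t" if "t \<le> T" for \<xi> t
      by (rule answers_null_record[OF y(2) S'(1) S'(2)[OF s] that])
    from this[OF order_refl] this[of s] s
      has_bochner_integral_ablq_given_shift[OF \<sigma> A E s y x[OF s] S(1)[OF s] S(2)[OF s]]
    show ?thesis by (simp add: v_def)
  qed
  moreover have eq: "a * (\<Sum>s<T. u * g s) + c * u = u * (a * (\<Sum>s<T. g s) + c)"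
      for u and g :: "nat \<Rightarrow> real"
    by (simp add: sum_distrib_left[symmetric] algebra_simps)
  ultimately have "has_bochner_integral (noise T d \<sigma>)
      (\<lambda>\<xi>. a * (\<Sum>s<T. indicator E (?F \<xi>) * shift_density \<sigma> {..<d} (v s \<xi>) (\<xi> s))
          + c * indicator E (?F \<xi>))
      (a * (\<Sum>s<T. measure (ablq_given d \<sigma> T A x (S s)) E) + c * measure (ablq_given d \<sigma> T A x' S') E)"
    by (intro has_bochner_integral_add has_bochner_integral_mult_right has_bochner_integral_sum
        has_bochner_integral_ablq_given[OF \<sigma> A E]) auto
  then have gap: "has_bochner_integral (noise T d \<sigma>) (\<lambda>\<xi>. indicator E (?F \<xi>) * (a * ?L \<xi> + c))
      (a * (\<Sum>s<T. measure (ablq_given d \<sigma> T A x (S s)) E) + c * measure (ablq_given d \<sigma> T A x' S') E)"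
    by (simp only: eq)
  have "a * (\<Sum>s<T. measure (ablq_given d \<sigma> T A x (S s)) E) + c * measure (ablq_given d \<sigma> T A x' S') E
      = (\<integral>\<xi>. indicator E (?F \<xi>) * (a * ?L \<xi> + c) \<partial>noise T d \<sigma>)"
    using gap by (simp add: has_bochner_integral_iff)
  also have "\<dots> \<le> (\<integral>\<xi>. max 0 (a * ?L \<xi> + c) \<partial>noise T d \<sigma>)"
    using gap L
    by (intro integral_mono integrable_max_0)
      (auto simp: has_bochner_integral_iff split: split_indicator)
  also have "\<dots> \<le> hockey_stick T \<sigma> a c"
  proof -
    \<comment> \<open>The comparison lives in \<open>ennreal\<close>; integrability of both positive
      parts carries it back to the reals.\<close>
    have "ennreal (\<integral>\<xi>. max 0 (a * ?L \<xi> + c) \<partial>noise T d \<sigma>)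
        = (\<integral>\<^sup>+ \<xi>. ennreal (max 0 (a * ?L \<xi> + c)) \<partial>noise T d \<sigma>)"
      using L by (intro nn_integral_eq_integral[symmetric] integrable_max_0) auto
    also have "\<dots> \<le> (\<integral>\<^sup>+ \<zeta>. ennreal (max 0 (a * ?L1 \<zeta> + c)) \<partial>noise T 1 \<sigma>)"
      by (rule nn_integral_jensen_adaptive_le[where v = v and n = T,
          OF \<sigma> jensen_function_convex[OF convex_on_max_0_affine max.cobounded1] v norm indep])
    also have "\<dots> = ennreal (hockey_stick T \<sigma> a c)"
      unfolding hockey_stick_def
      by (rule nn_integral_eq_integral[OF integrable_max_0[OF Bochner_Integration.integrable_add[OF
        integrable_mult_right[OF L1] N1.integrable_const]]]) simp
    finally show ?thesis
      by (subst (asm) ennreal_le_iff) (simp_all add: hockey_stick_def)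
  qed
  finally show ?thesis .
qed

lemma measure_ablq:
  assumes "\<sigma> > 0" "adaptive_query_method d A" "E \<in> sets (outputs T d)"
  shows "measure (ablq d \<sigma> T A G x) E
      = measure_pmf.expectation G (\<lambda>S. measure (ablq_given d \<sigma> T A x S) E)"
  unfolding ablq_def
proof (rule measure_pmf.measure_bind[OF _ assms(3)])
  show "ablq_given d \<sigma> T A x \<in> measure_pmf G \<rightarrow>\<^sub>M subprob_algebra (outputs T d)"
    using ablq_given_in_prob_algebra[OF assms(1,2)]
    by (auto simp: space_prob_algebra space_subprob_algebra prob_space_imp_subprob_space)
qed

lemma sets_ablq:
  assumes "\<sigma> > 0" "adaptive_query_method d A"
  shows "sets (ablq d \<sigma> T A G x) = sets (outputs T d)"
  using ablq_in_prob_algebra[OF assms] by (simp add: space_prob_algebra)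


section \<open>The shuffle generator\<close>

text \<open>Composition with a transposition shows that the sum is the same for every position
  \<open>m\<close>. Summing over all positions and using that each permutation is a bijection gives
  the value.\<close>

lemma sum_permutes_apply:
  fixes h :: "nat \<Rightarrow> real"
  assumes "m < n"
  shows "real n * (\<Sum>\<pi> | \<pi> permutes {..<n}. h (\<pi> m)) = fact n * (\<Sum>k<n. h k)"
proof -
  let ?S = "{\<pi>. \<pi> permutes {..<n}}"
  have swap: "(\<Sum>\<pi>\<in>?S. h (\<pi> m)) = (\<Sum>\<pi>\<in>?S. h (\<pi> j))" if "j < n" for j
    using sum_permutations_compose_right[OF permutes_swap_id, of m "{..<n}" j "\<lambda>\<pi>. h (\<pi> m)"]
      that assms
    by simp
  have "(\<Sum>j<n. \<Sum>\<pi>\<in>?S. h (\<pi> m)) = (\<Sum>j<n. \<Sum>\<pi>\<in>?S. h (\<pi> j))"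
    by (rule sum.cong[OF refl], rule swap) simp
  then have "real n * (\<Sum>\<pi>\<in>?S. h (\<pi> m)) = (\<Sum>j<n. \<Sum>\<pi>\<in>?S. h (\<pi> j))"
    by simp
  also have "\<dots> = (\<Sum>\<pi>\<in>?S. \<Sum>j<n. h (\<pi> j))"
    by (rule sum.swap)
  also have "\<dots> = (\<Sum>\<pi>\<in>?S. \<Sum>k<n. h k)"
    by (intro sum.cong refl sum.reindex_bij_betw permutes_imp_bij) simp
  also have "\<dots> = fact n * (\<Sum>k<n. h k)"
    by (simp add: card_permutations)
  finally show ?thesis .
qed

lemma mem_block_iff:
  fixes b k t :: nat
  assumes "b > 0"
  shows "k \<in> {t * b..<t * b + b} \<longleftrightarrow> t = k div b"
proof
  assume "k \<in> {t * b..<t * b + b}"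
  then show "t = k div b"
    by (intro div_nat_eqI[symmetric]) (auto simp: mult.commute)
next
  assume "t = k div b"
  then show "k \<in> {t * b..<t * b + b}"
    using dividend_less_div_times[OF assms, of k] by simp
qed

text \<open>Record 0 occupies position \<open>inv \<pi> 0\<close>, and position \<open>k\<close>
  belongs to batch \<open>k div b\<close>. As all batches have \<open>b\<close> positions, the batch
  of record 0 is uniform; inversion is a bijection on permutations, so \<open>\<pi>\<close> may
  replace \<open>inv \<pi>\<close>.\<close>

lemma sum_permutes_inv_block:
  fixes g :: "nat \<Rightarrow> real"
  assumes "b > 0" "T > 0"
  shows "(\<Sum>\<pi> | \<pi> permutes {..<b * T}. g (inv \<pi> 0 div b)) / fact (b * T) = (\<Sum>s<T. g s) / T"
proof -
  have "(\<Sum>k<b * T. g (k div b)) = (\<Sum>s<T. \<Sum>k\<in>{s * b..<s * b + b}. g (k div b))"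
    by (simp add: sum.nat_group mult.commute)
  also have "\<dots> = (\<Sum>s<T. \<Sum>k\<in>{s * b..<s * b + b}. g s)"
    using mem_block_iff[OF assms(1)] by (intro sum.cong refl arg_cong[where f = g]) metis
  also have "\<dots> = b * (\<Sum>s<T. g s)"
    by (simp add: sum_distrib_left)
  finally have "real (b * T) * (\<Sum>\<pi> | \<pi> permutes {..<b * T}. g (\<pi> 0 div b))
      = fact (b * T) * (b * (\<Sum>s<T. g s))"
    using sum_permutes_apply[of 0 "b * T" "\<lambda>k. g (k div b)"] assms by simp
  then have "real T * (\<Sum>\<pi> | \<pi> permutes {..<b * T}. g (\<pi> 0 div b)) = fact (b * T) * (\<Sum>s<T. g s)"
    using assms by simp
  then show ?thesis
    using assms sum_permutations_inverse[of "\<lambda>\<pi>. g (\<pi> 0 div b)" "{..<b * T}"]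
    by (simp add: field_simps)
qed

lemma measure_ablq_shuffle:
  assumes "\<sigma> > 0" "adaptive_query_method d A" "E \<in> sets (outputs T d)"
  shows "measure (ablq d \<sigma> T A (shuffle_batches b T) x) E =
    (\<Sum>\<pi> | \<pi> permutes {..<b * T}.
      measure (ablq_given d \<sigma> T A x (map (\<lambda>t. \<pi> ` {t * b..<t * b + b}) [0..<T])) E) / fact (b * T)"
proof -
  have "{\<pi>. \<pi> permutes {..<b * T}} \<noteq> {}" using permutes_id by blast
  then show ?thesis
    by (simp add: measure_ablq[OF assms] shuffle_batches_def integral_pmf_of_set
        finite_permutations card_permutations)
qed

lemma ablq_private_shuffle:
  assumes \<sigma>: "\<sigma> > 0" and priv: "ablq_private TYPE('x) deterministic_batches \<sigma> b T \<epsilon> \<delta>"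
  shows "ablq_private TYPE('x) shuffle_batches \<sigma> b T \<epsilon> \<delta>"
  unfolding ablq_private_def differentially_private_def
proof (intro allI impI ballI)
  fix d and A :: "(nat \<Rightarrow> real) list \<Rightarrow> 'x \<Rightarrow> (nat \<Rightarrow> real)" and x x' E
  assume d: "d \<ge> 1" and A: "adaptive_query_method d A" and adj: "adjacent (b * T) x x'"
    and "E \<in> sets (ablq d \<sigma> T A (shuffle_batches b T) x)"
  then have E: "E \<in> sets (outputs T d)" by (simp add: sets_ablq[OF \<sigma> A])
  let ?n = "b * T"
  let ?D = "map (\<lambda>t. {t * b..<t * b + b}) [0..<T]"
  let ?S = "\<lambda>\<pi>. map (\<lambda>t. \<pi> ` {t * b..<t * b + b}) [0..<T]"
  let ?x = "\<lambda>z \<pi>. map (\<lambda>k. z ! \<pi> k) [0..<?n]"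
  \<comment> \<open>Injectivity of \<open>\<pi>\<close> lets each batch sum be reindexed from the
    image of a block to the block itself.\<close>
  have given: "ablq_given d \<sigma> T A z (?S \<pi>) = ablq_given d \<sigma> T A (?x z \<pi>) ?D"
    if \<pi>: "\<pi> permutes {..<?n}" for z :: "'x option list" and \<pi>
  proof -
    have "answers d A (?S \<pi>) z \<xi> t = answers d A ?D (?x z \<pi>) \<xi> t" if "t \<le> T" for \<xi> t
      using that
    proof (induction t)
      case (Suc t)
      have inj: "inj_on \<pi> {t * b..<t * b + b}"
        using permutes_inj[OF \<pi>] by (rule inj_on_subset) simp
      have "k < ?n" if "k < t * b + b" for k
        using batch_index_less[OF _ that] Suc.prems by simp
      with Suc inj show ?case by (simp add: sum.reindex)
    qed simp
    then show ?thesis by (simp add: ablq_given_def)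
  qed
  have le: "measure (ablq_given d \<sigma> T A x (?S \<pi>)) E
      \<le> exp \<epsilon> * measure (ablq_given d \<sigma> T A x' (?S \<pi>)) E + \<delta>"
    if \<pi>: "\<pi> permutes {..<?n}" for \<pi>
  proof -
    obtain i where i: "i < ?n" "\<forall>j<?n. j \<noteq> i \<longrightarrow> x ! j = x' ! j" "(x ! i = None) \<noteq> (x' ! i = None)"
      using adj unfolding adjacent_def by blast
    have lt: "\<pi> k < ?n \<longleftrightarrow> k < ?n" for k
      using permutes_in_image[OF \<pi>, of k] by simp
    \<comment> \<open>The permuted data sets differ at the position that \<open>\<pi>\<close> sends
      to \<open>i\<close>.\<close>
    define m where "m = inv \<pi> i"
    have m: "\<pi> m = i" "m < ?n" "\<And>k. k \<noteq> m \<Longrightarrow> \<pi> k \<noteq> i"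
      using permutes_inverses[OF \<pi>] lt[of m] i(1) by (auto simp: m_def)
    have "adjacent ?n (?x x \<pi>) (?x x' \<pi>)"
      unfolding adjacent_def
    proof (intro conjI exI[of _ m] allI impI)
      show "?x x \<pi> ! j = ?x x' \<pi> ! j" if "j < ?n" "j \<noteq> m" for j
        using i(2) m(3)[OF that(2)] lt[of j] that(1) by simp
    qed (use i(3) m in simp_all)
    then have "measure (ablq d \<sigma> T A (deterministic_batches b T) (?x x \<pi>)) E
        \<le> exp \<epsilon> * measure (ablq d \<sigma> T A (deterministic_batches b T) (?x x' \<pi>)) E + \<delta>"
      using priv d A E sets_ablq[OF \<sigma> A] unfolding ablq_private_def differentially_private_def
          by blast
    then show ?thesis
      by (simp add: measure_ablq[OF \<sigma> A E] deterministic_batches_def given[OF \<pi>])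
  qed
  have "(\<Sum>\<pi> | \<pi> permutes {..<?n}. measure (ablq_given d \<sigma> T A x (?S \<pi>)) E)
      \<le> (\<Sum>\<pi> | \<pi> permutes {..<?n}. exp \<epsilon> * measure (ablq_given d \<sigma> T A x' (?S \<pi>)) E + \<delta>)"
    by (rule sum_mono) (use le in simp)
  also have "\<dots> = exp \<epsilon> * (\<Sum>\<pi> | \<pi> permutes {..<?n}. measure (ablq_given d \<sigma> T A x' (?S \<pi>)) E)
      + fact ?n * \<delta>"
    by (simp add: sum.distrib sum_distrib_left card_permutations)
  finally show "measure (ablq d \<sigma> T A (shuffle_batches b T) x) E
      \<le> exp \<epsilon> * measure (ablq d \<sigma> T A (shuffle_batches b T) x') E + \<delta>"
    by (simp add: measure_ablq_shuffle[OF \<sigma> A E] field_simps)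
qed

text \<open>The bound of \<open>ablq_given_gap_le_hockey_stick\<close> is attained. When the
  remaining records are null, the reference output is the noise itself, so the ratios become
  functions of the output and the optimal event is available to an observer.\<close>

lemma hockey_stick_le_shuffle:
  fixes b T :: nat
  assumes \<sigma>: "\<sigma> > 0" and bT: "b > 0" "T > 0"
    and priv: "ablq_private TYPE('x) shuffle_batches \<sigma> b T \<epsilon> \<delta>"
  shows "hockey_stick T \<sigma> (1 / T) (- exp \<epsilon>) \<le> \<delta>"
    and "hockey_stick T \<sigma> (- exp \<epsilon> / T) 1 \<le> \<delta>"
proof -
  interpret prob_space "noise T 1 \<sigma>" by (rule prob_space_noise[OF \<sigma>])
  let ?n = "b * T"
  have n: "0 < ?n" using bT by simp
  define A :: "(nat \<Rightarrow> real) list \<Rightarrow> 'x \<Rightarrow> nat \<Rightarrow> real" where "A = (\<lambda>_ _. \<lambda>j\<in>{..<1}. 1)"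
  have A: "adaptive_query_method 1 A"
    unfolding adaptive_query_method_def A_def by (auto simp: space_PiM L2_set_def)
  define x' :: "'x option list" where "x' = replicate ?n None"
  define x where "x = x'[0 := Some undefined]"
  have xs: "x ! 0 = Some undefined" "x' ! 0 = None" "\<And>k. k \<noteq> 0 \<Longrightarrow> x ! k = x' ! k"
    and x'k: "\<And>k. k < ?n \<Longrightarrow> x' ! k = None"
    using n by (auto simp: x_def x'_def)
  have adj: "adjacent ?n x x'" "adjacent ?n x' x"
    unfolding adjacent_def using n xs by (auto simp: x_def x'_def intro!: exI[of _ 0])
  let ?sd = "\<lambda>\<zeta> t. shift_density \<sigma> {..<1::nat} (\<lambda>_. 1) (\<zeta> t)"
  let ?L = "\<lambda>\<zeta>. \<Sum>t<T. ?sd \<zeta> t"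
  have L: "integrable (noise T 1 \<sigma>) ?L"
    by (intro Bochner_Integration.integrable_sum integrable_shift_density_one[OF \<sigma>]) auto
  let ?S = "\<lambda>\<pi>. map (\<lambda>t. \<pi> ` {t * b..<t * b + b}) [0..<T]"
  \<comment> \<open>All sums vanish on \<open>x'\<close>, which leaves the noise. Equality of
    functions holds on the space of the noise, whose members are extensional in the step and in the
    coordinate.\<close>
  have F: "(\<lambda>t\<in>{..<T}. answers 1 A (?S \<pi>) x' \<xi> T ! t) = \<xi>"
    if \<pi>: "\<pi> permutes {..<?n}" and \<xi>: "\<xi> \<in> space (noise T 1 \<sigma>)" for \<pi> \<xi>
  proof -
    have \<xi>': "\<xi> \<in> space (outputs T 1)"
      using \<xi> by (metis sets_PiM_gaussian_noise sets_eq_imp_space_eq)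
    have "answers 1 A (?S \<pi>) x' \<xi> t = map \<xi> [0..<t]" if "t \<le> T" for t
      using that
    proof (induction t)
      case (Suc t)
      have "x' ! k = None" if "k \<in> \<pi> ` {t * b..<t * b + b}" for k
      proof -
        from that obtain m where "k = \<pi> m" "m < t * b + b" by auto
        then have "k < ?n"
          using batch_index_less[of t T m b] Suc.prems permutes_in_image[OF \<pi>, of m] by simp
        then show ?thesis by (rule x'k)
      qed
      moreover have "(\<lambda>j\<in>{..<1}. \<xi> t j) = \<xi> t"
        using \<xi>' Suc.prems by (intro PiE_restrict[of _ _ "\<lambda>_. UNIV"]) (auto simp: space_PiM)
      ultimately show ?case using Suc by (simp cong: restrict_cong)
    qed simp
    from this[OF order_refl] show ?thesis
      using \<xi>' by (auto simp: fun_eq_iff space_PiM PiE_def extensional_def restrict_def)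
  qed
  \<comment> \<open>Relative to the law of the noise, the mechanism on \<open>x\<close> has density
    \<open>?L / T\<close> and on \<open>x'\<close> density 1.\<close>
  have pr: "measure (ablq 1 \<sigma> T A (shuffle_batches b T) x) E
      = (\<integral>\<zeta>. indicator E \<zeta> * ?L \<zeta> \<partial>noise T 1 \<sigma>) / T"
    "measure (ablq 1 \<sigma> T A (shuffle_batches b T) x') E = (\<integral>\<zeta>. indicator E \<zeta> \<partial>noise T 1 \<sigma>)"
    if E: "E \<in> sets (outputs T 1)" for E
  proof -
    have Em [measurable]: "E \<in> sets (noise T 1 \<sigma>)" using E by (simp add: sets_PiM_gaussian_noise)
    \<comment> \<open>\<open>?g s\<close> is the probability of \<open>E\<close> when record 0 falls
      into batch \<open>s\<close>.\<close>
    let ?g = "\<lambda>s. \<integral>\<zeta>. indicator E \<zeta> * ?sd \<zeta> s \<partial>noise T 1 \<sigma>"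
    have "measure (ablq_given 1 \<sigma> T A x (?S \<pi>)) E = ?g (inv \<pi> 0 div b)"
      if \<pi>: "\<pi> permutes {..<?n}" for \<pi>
    proof -
      let ?s = "inv \<pi> 0 div b"
      have "inv \<pi> 0 < ?n"
        using permutes_in_image[OF permutes_inv[OF \<pi>], of 0] n by simp
      then have s: "?s < T" using bT by (simp add: less_mult_imp_div_less mult.commute)
      have mem: "0 \<in> ?S \<pi> ! t \<longleftrightarrow> t = ?s" if "t < T" for t
      proof -
        have "0 \<in> \<pi> ` B \<longleftrightarrow> inv \<pi> 0 \<in> B" for B
          using permutes_inverses[OF \<pi>] by (metis imageE image_eqI)
        then have "0 \<in> ?S \<pi> ! t \<longleftrightarrow> inv \<pi> 0 \<in> {t * b..<t * b + b}"
          using that by simp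
        also have "\<dots> \<longleftrightarrow> t = ?s"
          by (rule mem_block_iff[OF bT(1)])
        finally show ?thesis .
      qed
      have "has_bochner_integral (noise T 1 \<sigma>)
          (\<lambda>\<xi>. indicator E (\<lambda>t\<in>{..<T}. answers 1 A (?S \<pi>) x' \<xi> T ! t) *
            shift_density \<sigma> {..<1} (A (answers 1 A (?S \<pi>) x' \<xi> ?s) undefined) (\<xi> ?s))
          (measure (ablq_given 1 \<sigma> T A x (?S \<pi>)) E)"
        by (rule has_bochner_integral_ablq_given_shift[OF \<sigma> A E s xs(1,2)]) (use xs(3) mem in auto)
      moreover have "indicator E (\<lambda>t\<in>{..<T}. answers 1 A (?S \<pi>) x' \<xi> T ! t) *
            shift_density \<sigma> {..<1} (A (answers 1 A (?S \<pi>) x' \<xi> ?s) undefined) (\<xi> ?s)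
          = indicator E \<xi> * ?sd \<xi> ?s" if "\<xi> \<in> space (noise T 1 \<sigma>)" for \<xi>
        unfolding F[OF \<pi> that] unfolding A_def shift_density_one_cong by (rule refl)
      ultimately have "has_bochner_integral (noise T 1 \<sigma>) (\<lambda>\<xi>. indicator E \<xi> * ?sd \<xi> ?s)
          (measure (ablq_given 1 \<sigma> T A x (?S \<pi>)) E)"
        by (rule iffD1[OF has_bochner_integral_cong[OF refl _ refl], rotated])
      then show ?thesis by (simp add: has_bochner_integral_iff)
    qed
    then have "(\<Sum>\<pi> | \<pi> permutes {..<?n}. measure (ablq_given 1 \<sigma> T A x (?S \<pi>)) E)
        = (\<Sum>\<pi> | \<pi> permutes {..<?n}. ?g (inv \<pi> 0 div b))"
      by (intro sum.cong[OF refl]) blast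
    then have "measure (ablq 1 \<sigma> T A (shuffle_batches b T) x) E = (\<Sum>s<T. ?g s) / T"
      unfolding measure_ablq_shuffle[OF \<sigma> A E] by (simp only: sum_permutes_inv_block[OF bT, of ?g])
    also have "(\<Sum>s<T. ?g s) = (\<integral>\<zeta>. (\<Sum>s<T. indicator E \<zeta> * ?sd \<zeta> s) \<partial>noise T 1 \<sigma>)"
    proof (rule Bochner_Integration.integral_sum[symmetric])
      fix s assume "s \<in> {..<T}"
      then have "integrable (noise T 1 \<sigma>) (\<lambda>\<zeta>. ?sd \<zeta> s)"
        by (intro integrable_shift_density_one[OF \<sigma>]) simp
      from integrable_real_mult_indicator[OF Em this]
      show "integrable (noise T 1 \<sigma>) (\<lambda>\<zeta>. indicator E \<zeta> * ?sd \<zeta> s)"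
        by (simp only: mult.commute)
    qed
    also have "\<dots> = (\<integral>\<zeta>. indicator E \<zeta> * ?L \<zeta> \<partial>noise T 1 \<sigma>)"
      by (simp only: sum_distrib_left)
    finally show "measure (ablq 1 \<sigma> T A (shuffle_batches b T) x) E
        = (\<integral>\<zeta>. indicator E \<zeta> * ?L \<zeta> \<partial>noise T 1 \<sigma>) / T" .
    have "measure (ablq_given 1 \<sigma> T A x' (?S \<pi>)) E = (\<integral>\<zeta>. indicator E \<zeta> \<partial>noise T 1 \<sigma>)"
      if \<pi>: "\<pi> permutes {..<?n}" for \<pi>
    proof -
      have "has_bochner_integral (noise T 1 \<sigma>) (\<lambda>\<xi>. indicator E \<xi>)
          (measure (ablq_given 1 \<sigma> T A x' (?S \<pi>)) E)"
        by (rule iffD1[OF has_bochner_integral_cong[OF refl _ refl]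
            has_bochner_integral_ablq_given[OF \<sigma> A E]])
          (simp only: F[OF \<pi>])
      then show ?thesis by (simp add: has_bochner_integral_iff)
    qed
    then have "(\<Sum>\<pi> | \<pi> permutes {..<?n}. measure (ablq_given 1 \<sigma> T A x' (?S \<pi>)) E)
        = (\<Sum>\<pi> | \<pi> permutes {..<?n}. \<integral>\<zeta>. indicator E \<zeta> \<partial>noise T 1 \<sigma>)"
      by (intro sum.cong[OF refl]) blast
    then show "measure (ablq 1 \<sigma> T A (shuffle_batches b T) x') E = (\<integral>\<zeta>. indicator E \<zeta> \<partial>noise T 1 \<sigma>)"
      unfolding measure_ablq_shuffle[OF \<sigma> A E] by (simp add: card_permutations)
  qed
  have hs: "\<exists>E\<in>sets (outputs T 1). hockey_stick T \<sigma> a c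
      = a * T * measure (ablq 1 \<sigma> T A (shuffle_batches b T) x) E
        + c * measure (ablq 1 \<sigma> T A (shuffle_batches b T) x') E"
    for a c
  proof -
    \<comment> \<open>The event on which the integrand is positive: there the positive part equals
      the affine expression, and elsewhere it is zero. The factor \<open>T\<close> in the claim
      undoes the averaging over batches in \<open>pr\<close>.\<close>
    let ?E = "{\<zeta> \<in> space (noise T 1 \<sigma>). a * ?L \<zeta> + c > 0}"
    have [measurable]: "?L \<in> borel_measurable (noise T 1 \<sigma>)" using L by simp
    have Em: "?E \<in> sets (noise T 1 \<sigma>)" by measurable
    then have E: "?E \<in> sets (outputs T 1)" by (simp only: sets_PiM_gaussian_noise)
    have "hockey_stick T \<sigma> a c = (\<integral>\<zeta>. a * (indicator ?E \<zeta> * ?L \<zeta>) + c * indicator ?E \<zeta> \<partial>noise T 1 \<sigma>)"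
      unfolding hockey_stick_def
      by (intro Bochner_Integration.integral_cong) (auto split: split_indicator)
    also have "\<dots> = a * (\<integral>\<zeta>. indicator ?E \<zeta> * ?L \<zeta> \<partial>noise T 1 \<sigma>)
        + c * (\<integral>\<zeta>. indicator ?E \<zeta> \<partial>noise T 1 \<sigma>)"
    proof -
      have "integrable (noise T 1 \<sigma>) (\<lambda>\<zeta>. indicator ?E \<zeta> * ?L \<zeta>)"
        using integrable_real_mult_indicator[OF Em L] by (simp only: mult.commute)
      moreover have "integrable (noise T 1 \<sigma>) (\<lambda>\<zeta>. indicator ?E \<zeta> :: real)"
        by (rule integrable_real_indicator[OF Em])
            (simp only: emeasure_eq_measure infinity_ennreal_def ennreal_less_top)
      ultimately show ?thesis
        by (simp only: Bochner_Integration.integral_add integrable_mult_right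
            integral_mult_right_zero)
    qed
    also have "\<dots> = a * T * measure (ablq 1 \<sigma> T A (shuffle_batches b T) x) ?E
        + c * measure (ablq 1 \<sigma> T A (shuffle_batches b T) x') ?E"
    proof -
      have "a * u = a * real T * (u / T)" for u
        using bT by simp
      then show ?thesis unfolding pr[OF E] by (rule arg_cong[where f = "\<lambda>u. u + _"])
    qed
    finally show ?thesis using E by blast
  qed
  have dp: "measure (ablq 1 \<sigma> T A (shuffle_batches b T) z) E
      \<le> exp \<epsilon> * measure (ablq 1 \<sigma> T A (shuffle_batches b T) z') E + \<delta>"
    if "adjacent ?n z z'" "E \<in> sets (outputs T 1)" for z z' E
    by (rule priv[unfolded ablq_private_def differentially_private_def, rule_format,
        OF order_refl A that(1)])
      (simp only: sets_ablq[OF \<sigma> A] that(2))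
  show "hockey_stick T \<sigma> (1 / T) (- exp \<epsilon>) \<le> \<delta>"
  proof -
    obtain E where E: "E \<in> sets (outputs T 1)"
      "hockey_stick T \<sigma> (1 / T) (- exp \<epsilon>)
          = 1 / T * T * measure (ablq 1 \<sigma> T A (shuffle_batches b T) x) E
        + - exp \<epsilon> * measure (ablq 1 \<sigma> T A (shuffle_batches b T) x') E"
      using hs by blast
    then show ?thesis using dp[OF adj(1) E(1)] bT by simp
  qed
  show "hockey_stick T \<sigma> (- exp \<epsilon> / T) 1 \<le> \<delta>"
  proof -
    obtain E where E: "E \<in> sets (outputs T 1)"
      "hockey_stick T \<sigma> (- exp \<epsilon> / T) 1
          = - exp \<epsilon> / T * T * measure (ablq 1 \<sigma> T A (shuffle_batches b T) x) E
        + 1 * measure (ablq 1 \<sigma> T A (shuffle_batches b T) x') E"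
      using hs by blast
    then show ?thesis using dp[OF adj(2) E(1)] bT by simp
  qed
qed


section \<open>The balls-and-bins generator\<close>

text \<open>The inequality is shown for each assignment of the other records and then averaged. The
  hypothesis \<open>h1\<close> serves the case in which \<open>x\<close> holds the differing record,
  \<open>h2\<close> the case in which \<open>x'\<close> does.\<close>

lemma ablq_private_balls_and_bins:
  fixes b T :: nat
  assumes \<sigma>: "\<sigma> > 0" and T: "T > 0"
    and h1: "hockey_stick T \<sigma> (1 / T) (- exp \<epsilon>) \<le> \<delta>"
    and h2: "hockey_stick T \<sigma> (- exp \<epsilon> / T) 1 \<le> \<delta>"
  shows "ablq_private TYPE('x) balls_and_bins_batches \<sigma> b T \<epsilon> \<delta>"
  unfolding ablq_private_def differentially_private_def
proof (intro allI impI ballI)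
  fix d and A :: "(nat \<Rightarrow> real) list \<Rightarrow> 'x \<Rightarrow> (nat \<Rightarrow> real)" and x x' E
  assume d: "d \<ge> 1" and A: "adaptive_query_method d A" and adj: "adjacent (b * T) x x'"
    and "E \<in> sets (ablq d \<sigma> T A (balls_and_bins_batches b T) x)"
  then have E: "E \<in> sets (outputs T d)" by (simp add: sets_ablq[OF \<sigma> A])
  let ?n = "b * T"
  obtain i where i: "i < ?n" "\<And>j. j < ?n \<Longrightarrow> j \<noteq> i \<Longrightarrow> x ! j = x' ! j" "(x ! i = None) \<noteq> (x' ! i = None)"
    using adj unfolding adjacent_def by blast
  define B where "B f = map (\<lambda>t. {k. k < ?n \<and> f k = t}) [0..<T]" for f
  \<comment> \<open>The law of the bins of all records but \<open>i\<close>. A sample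
    \<open>f\<close> has the default \<open>f i = 0\<close>, so \<open>B f\<close> puts record
    \<open>i\<close> into batch 0; this is harmless because \<open>B f\<close> is run only on data
    in which record \<open>i\<close> is null.\<close>
  define R where "R = Pi_pmf ({..<?n} - {i}) 0 (\<lambda>_. pmf_of_set {..<T})"
  have ne: "{..<T} \<noteq> {}" using T by (auto simp: lessThan_empty_iff)
  have fin: "finite (set_pmf R)"
    unfolding R_def
    by (rule finite_subset[OF set_Pi_pmf_subset'])
      (auto simp: set_pmf_of_set[OF ne] intro!: finite_PiE_dflt)
  \<comment> \<open>By independence the bin of record \<open>i\<close> can be drawn after all the
    others.\<close>
  have G: "balls_and_bins_batches b T
      = R \<bind> (\<lambda>f. map_pmf (\<lambda>s. B (f(i := s))) (pmf_of_set {..<T}))"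
  proof -
    have "{..<?n} = insert i ({..<?n} - {i})" using i(1) by auto
    then have "Pi_pmf {..<?n} 0 (\<lambda>_. pmf_of_set {..<T})
        = map_pmf (\<lambda>(s, f). f(i := s)) (pair_pmf (pmf_of_set {..<T}) R)"
      unfolding R_def by (metis Pi_pmf_insert Diff_iff finite_Diff finite_lessThan insertI1)
    also have "\<dots> = map_pmf (\<lambda>(f, s). f(i := s)) (pair_pmf R (pmf_of_set {..<T}))"
      by (subst pair_commute_pmf) (simp add: pmf.map_comp comp_def case_prod_beta')
    also have "\<dots> = R \<bind> (\<lambda>f. map_pmf (\<lambda>s. f(i := s)) (pmf_of_set {..<T}))"
      by (simp add: pair_pmf_def map_bind_pmf map_pmf_def bind_assoc_pmf bind_return_pmf)
    finally show ?thesis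
      by (simp add: balls_and_bins_batches_def B_def map_bind_pmf pmf.map_comp comp_def)
  qed
  let ?m = "\<lambda>z f s. measure (ablq_given d \<sigma> T A z (B (f(i := s)))) E"
  have ablq: "measure (ablq d \<sigma> T A (balls_and_bins_batches b T) z) E
      = (\<Sum>f\<in>set_pmf R. pmf R f * ((\<Sum>s<T. ?m z f s) / T))" for z
    unfolding measure_ablq[OF \<sigma> A E] G
    by (subst pmf_expectation_bind[OF fin])
        (auto simp: set_pmf_of_set[OF ne] integral_pmf_of_set[OF ne])
  have B: "finite (B f ! t)" "B (f(i := s)) ! t - {i} = B f ! t - {i}" "i \<in> B (f(i := s)) ! t \<longleftrightarrow> t = s"
    "k \<in> B f ! t \<Longrightarrow> k < ?n" if "t < T" for f s t k
    using that i(1) by (auto simp: B_def)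
  \<comment> \<open>On the null side the probability is the same for every bin \<open>s\<close>, so
    its average over \<open>s\<close> collapses to the single reference run.\<close>
  have gap: "a * (\<Sum>s<T. ?m z f s) + c * ((\<Sum>s<T. ?m z' f s) / T) \<le> hockey_stick T \<sigma> a c"
    if z: "z ! i = Some y" "z' ! i = None" "\<And>k. k < ?n \<Longrightarrow> k \<noteq> i \<Longrightarrow> z ! k = z' ! k" for a c z z' y f
  proof -
    have "answers d A (B (f(i := s))) z' \<xi> T = answers d A (B f) z' \<xi> T" for \<xi> s
      by (rule answers_null_record[OF z(2) B(1,2) order_refl])
    then have "?m z' f s = measure (ablq_given d \<sigma> T A z' (B f)) E" for s
      by (simp add: ablq_given_def)
    then have "(\<Sum>s<T. ?m z' f s) / T = measure (ablq_given d \<sigma> T A z' (B f)) E"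
      using T by simp
    then show ?thesis
      using ablq_given_gap_le_hockey_stick[OF \<sigma> A E z(1,2), of "\<lambda>s. B (f(i := s))" "B f" a c] B z(3)
      by simp
  qed
  have one: "(\<Sum>f\<in>set_pmf R. pmf R f) = 1"
    by (rule sum_pmf_eq_1[OF fin order_refl])
  \<comment> \<open>The privacy inequality is affine in the pair of probabilities and the weights of
    \<open>R\<close> sum to 1, so it survives averaging with unchanged
    \<open>\<delta>\<close>.\<close>
  have mix: "(\<Sum>f\<in>set_pmf R. pmf R f * u f) \<le> exp \<epsilon> * (\<Sum>f\<in>set_pmf R. pmf R f * w f) + \<delta>"
    if "\<And>f. u f \<le> exp \<epsilon> * w f + \<delta>" for u w
  proof -
    have "(\<Sum>f\<in>set_pmf R. pmf R f * u f) \<le> (\<Sum>f\<in>set_pmf R. pmf R f * (exp \<epsilon> * w f + \<delta>))"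
      by (intro sum_mono mult_left_mono that) simp
    also have "\<dots> = exp \<epsilon> * (\<Sum>f\<in>set_pmf R. pmf R f * w f) + (\<Sum>f\<in>set_pmf R. pmf R f) * \<delta>"
      by (simp add: algebra_simps sum.distrib sum_distrib_left sum_distrib_right)
    finally show ?thesis by (simp add: one)
  qed
  show "measure (ablq d \<sigma> T A (balls_and_bins_batches b T) x) E
      \<le> exp \<epsilon> * measure (ablq d \<sigma> T A (balls_and_bins_batches b T) x') E + \<delta>"
    unfolding ablq
  proof (rule mix)
    fix f
    show "(\<Sum>s<T. ?m x f s) / T \<le> exp \<epsilon> * ((\<Sum>s<T. ?m x' f s) / T) + \<delta>"
    proof (cases "x ! i")
      case None
      then obtain y where "x' ! i = Some y" using i(3) by auto
      from gap[OF this None, of "- exp \<epsilon> / T" f 1] i(2) h2 show ?thesis by simp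
    next
      case (Some y)
      then have "x' ! i = None" using i(3) by auto
      from gap[OF Some this, of "1 / T" f "- exp \<epsilon>"] i(2) h1 show ?thesis by simp
    qed
  qed
qed

theorem proposition3p3:
  fixes \<epsilon> \<sigma> :: real and b T :: nat
  assumes "\<epsilon> > 0" and "\<sigma> > 0" and "T \<ge> 1" and "b \<ge> 1"
  shows "privacy_loss_curve TYPE('x) balls_and_bins_batches \<sigma> b T \<epsilon>
           \<le> privacy_loss_curve TYPE('x) shuffle_batches \<sigma> b T \<epsilon>
       \<and> privacy_loss_curve TYPE('x) shuffle_batches \<sigma> b T \<epsilon>
           \<le> privacy_loss_curve TYPE('x) deterministic_batches \<sigma> b T \<epsilon>"
proof
  note least = privacy_loss_curve_is_least[OF \<open>\<sigma> > 0\<close>,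
      where X = "TYPE('x)" and b = b and T = T and \<epsilon> = \<epsilon>]
  have "b > 0" "T > 0" using assms by auto
  \<comment> \<open>The optimal value for shuffling bounds both hockey-stick integrals, and this
    bound suffices for Balls-and-Bins.\<close>
  from hockey_stick_le_shuffle[OF \<open>\<sigma> > 0\<close> this least(2)[of shuffle_batches]]
  show "privacy_loss_curve TYPE('x) balls_and_bins_batches \<sigma> b T \<epsilon>
      \<le> privacy_loss_curve TYPE('x) shuffle_batches \<sigma> b T \<epsilon>"
    by (intro least(3) least(1) ablq_private_balls_and_bins[OF \<open>\<sigma> > 0\<close> \<open>T > 0\<close>])
  show "privacy_loss_curve TYPE('x) shuffle_batches \<sigma> b T \<epsilon>
      \<le> privacy_loss_curve TYPE('x) deterministic_batches \<sigma> b T \<epsilon>"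
    by (intro least(3) least(1) ablq_private_shuffle[OF \<open>\<sigma> > 0\<close> least(2)])
qed

end
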